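(* Let $\nu_0=n-\nu_1-\cdots-\nu_p$. Problem 1B (stated in the context) is solvable if and only if $$\dim\Big(\mathcal V^\star_g+\sum_{(i,j)\in P}\mathcal R_i(\lambda_{i,j})\Big)\ge\operatorname{card}P+\nu_0$$ and $$\dim\Big(\sum_{(i,j)\in P}\mathcal R_i(\lambda_{i,j})\Big)\ge\operatorname{card}P$$ for all $P$ in the power set $2^I$, where $I=\{(1,1),\ldots,(1,\nu_1),\ldots,(p,1),\ldots,(p,\nu_p)\}$.
   Context: System: $\Sigma=(A,B,C,D)$ is $\mathcal D x=Ax+Bu$, $y=Cx+Du$, $x(t)\in\mathbb R^n$, $u(t)\in\mathbb R^m$, $y(t)\in\mathbb R^p$, real matrices; $\mathcal D x=\dot x$ (continuous time) or $x(t+1)$ (discrete time). $\mathbb C_g$ is the open left half-plane (continuous) or open unit disc (discrete), $\mathbb R_g=\mathbb C_g\cap\mathbb R$. $\mathcal Z$ is the set of invariant zeros of $\Sigma$: those $\lambda\in\mathbb C$ at which the rank of $\begin{bmatrix}A-\lambda I&B\\C&D\end{bmatrix}$ is below its normal rank; minimum-phase zeros are those in $\mathbb C_g$. Standing assumptions: $\Sigma$ is right invertible (that matrix pencil has full row rank for all but finitely many $\lambda$), stabilizable, with no invariant zero at $0$ (continuous) or $1$ (discrete); algebraic and geometric multiplicities of each minimum-phase invariant zero coincide; no Jordan chains are allowed in the closed loop ($A+BF$ diagonalizable); in this part all closed-loop eigenvalues considered and all minimum-phase invariant zeros are real. Control: $u=Fx+Gr$, $F$ real with $\sigma(A+BF)\subset\mathbb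 C_g$, $G$ a right inverse of the closed-loop static gain. For constant $r$, $\epsilon=y-r$ satisfies $\mathcal D\xi=(A+BF)\xi$, $\epsilon=(C+DF)\xi$. State-to-output decoupling: for any initial condition, $\epsilon_i(t)=\sum_{j=1}^{\nu_i}\beta_{i,j}e^{\lambda_{i,j}t}$ (resp. $\sum_j\beta_{i,j}\lambda_{i,j}^t$), $i=1,\ldots,p$, where the $\lambda_{i,j}$ are the observable closed-loop eigenvalues and the coefficients $\beta_{i,j}$ can be made arbitrary by choice of $\xi(0)$. That is, $A+BF$ has a basis of eigenvectors $v_{0,1},\ldots,v_{0,\nu_0},v_{1,1},\ldots,v_{p,\nu_p}$ with eigenvalues $\lambda_{i,j}$ such that $(C+DF)v_{0,j}=0$ and $(C+DF)v_{i,j}$ is a nonzero multiple of the $i$-th canonical vector $e_i\in\mathbb R^p$ for $i\ge1$; the $\lambda_{i,j}$ ($1\le j\le\nu_i$) are the eigenvalues observable from $\epsilon_i$ and the $\lambda_{0,j}$ the unobservable ones (all counted with multiplicity). Problem 1B: given nonnegative integers $\nu_1,\ldots,\nu_p$ with $\nu_0=n-\sum_i\nu_i\ge0$ and assigned $\lambda_{i,j}\in\mathbb R_g\setminus\mathcal Z$ ($i=1,\ldots,p$, $j=1,\ldots,\nu_i$), find $F,G$ such that: (1) $y(t)\to\bar r$ for every constant reference $r(t)=\bar r$; (2) state-to-output decoupling is achieved; (3) from each $\epsilon_i$ exactly $\nu_i$ eigenvalues are observable and they are not invariant zeros; and the eigenvalues observable from $\epsilon_i$ are exactly $\{\lambda_{i,j}\}_{j=1,\ldots,\nu_i}$,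 while the $\nu_0$ unobservable eigenvalues are not assigned a priori (but are stable and may be invariant zeros). Solvable means such $F,G$ exist. Subspaces: $\mathcal R_i(\lambda)=\{v\in\mathbb R^n\mid\exists w\in\mathbb R^m:\ (A-\lambda I)v+Bw=0,\ C_{(i)}v+D_{(i)}w=0\}$ for real $\lambda$, where $C_{(i)},D_{(i)}$ are $C,D$ with the $i$-th row removed. $\mathcal V^\star_g$ is the largest stabilizability output-nulling subspace of $\Sigma$: the largest subspace $\mathcal V\subseteq\mathbb R^n$ for which there is a real $F$ with $(A+BF)\mathcal V\subseteq\mathcal V\subseteq\ker(C+DF)$ and $\sigma(A+BF|\mathcal V)\subset\mathbb C_g$. *)

theory Defs
  imports "HOL-Analysis.Analysis" "HOL-Computational_Algebra.Polynomial_Factorial"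
    "HOL-Computational_Algebra.Field_as_Ring"
    "HOL-Combinatorics.Permutations"
begin

section \<open>Time domains and signals\<close>

datatype time_domain = Continuous | Discrete

definition stability_region :: "time_domain \<Rightarrow> complex set" where
  "stability_region \<tau> =
     (case \<tau> of Continuous \<Rightarrow> {z. Re z < 0} | Discrete \<Rightarrow> {z. cmod z < 1})"

text \<open>Signals are functions on the reals in both cases; only their values on \<open>time_set\<close>
  are ever referred to.\<close>

definition time_set :: "time_domain \<Rightarrow> real set" where
  "time_set \<tau> = (case \<tau> of Continuous \<Rightarrow> {0..} | Discrete \<Rightarrow> \<nat>)"

definition time_at_top :: "time_domain \<Rightarrow> real filter" where
  "time_at_top \<tau> = inf at_top (principal (time_set \<tau>))"

text \<open>\<open>evolves \<tau> x g\<close> says that \<open>\<D> x = g\<close>, where \<open>\<D> x\<close> is the derivative of \<open>x\<close>, respectively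
  its forward shift.\<close>

definition evolves :: "time_domain \<Rightarrow> (real \<Rightarrow> 'v) \<Rightarrow> (real \<Rightarrow> 'v::real_normed_vector) \<Rightarrow> bool" where
  "evolves \<tau> x g =
     (case \<tau> of
        Continuous \<Rightarrow> (\<forall>t\<in>time_set \<tau>. (x has_vector_derivative g t) (at t within time_set \<tau>))
      | Discrete \<Rightarrow> (\<forall>t\<in>time_set \<tau>. x (t + 1) = g t))"

text \<open>The scalar mode: \<open>e\<^sup>\<mu>\<^sup>t\<close> or \<open>\<mu>\<^sup>t\<close>.\<close>

definition mode :: "time_domain \<Rightarrow> real \<Rightarrow> real \<Rightarrow> real" where
  "mode \<tau> \<mu> t = (case \<tau> of Continuous \<Rightarrow> exp (\<mu> * t) | Discrete \<Rightarrow> \<mu> ^ nat \<lfloor>t\<rfloor>)"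


section \<open>Spectra of real matrices\<close>

text \<open>The complex spectrum of the restriction of \<open>M\<close> to an invariant real subspace \<open>V\<close>: the
  eigenvectors range over the complexification of \<open>V\<close>.\<close>

definition spectrum_on :: "real^'n^'n \<Rightarrow> (real^'n) set \<Rightarrow> complex set" where
  "spectrum_on M V =
     {z. \<exists>w :: complex^'n. w \<noteq> 0 \<and> (\<chi> i. Re (w $ i)) \<in> V \<and> (\<chi> i. Im (w $ i)) \<in> V \<and>
           map_matrix complex_of_real M *v w = z *s w}"

abbreviation spectrum :: "real^'n^'n \<Rightarrow> complex set" where
  "spectrum M \<equiv> spectrum_on M UNIV"


section \<open>System pencil and invariant zeros\<close>

definition system_pencil ::
  "real^'n^'n \<Rightarrow> real^'m^'n \<Rightarrow> real^'n^'p \<Rightarrow> real^'m^'p \<Rightarrow> complex poly^('n + 'm)^('n + 'p)" where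
  "system_pencil A B C D =
     (\<chi> r c. case r of
        Inl i \<Rightarrow> (case c of
            Inl j \<Rightarrow> [:complex_of_real (A $ i $ j):] - (if i = j then [:0, 1:] else 0)
          | Inr k \<Rightarrow> [:complex_of_real (B $ i $ k):])
      | Inr l \<Rightarrow> (case c of
            Inl j \<Rightarrow> [:complex_of_real (C $ l $ j):]
          | Inr k \<Rightarrow> [:complex_of_real (D $ l $ k):]))"

definition eval_matrix :: "'a::comm_ring_1 poly^'c^'r \<Rightarrow> 'a \<Rightarrow> 'a^'c^'r" where
  "eval_matrix P z = map_matrix (\<lambda>q. poly q z) P"

definition normal_rank :: "complex poly^'c^'r \<Rightarrow> nat" where
  "normal_rank P = Max (range (\<lambda>z. rank (eval_matrix P z)))"

definition invariant_zeros ::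
  "real^'n^'n \<Rightarrow> real^'m^'n \<Rightarrow> real^'n^'p \<Rightarrow> real^'m^'p \<Rightarrow> complex set" where
  "invariant_zeros A B C D =
     {z. rank (eval_matrix (system_pencil A B C D) z) < normal_rank (system_pencil A B C D)}"

text \<open>The minor of order \<open>k\<close> on the rows \<open>f 0, \<dots>, f (k - 1)\<close> and the columns
  \<open>g 0, \<dots>, g (k - 1)\<close>, by the Leibniz formula.\<close>

definition minor ::
  "nat \<Rightarrow> (nat \<Rightarrow> 'r) \<Rightarrow> (nat \<Rightarrow> 'c) \<Rightarrow> 'a::comm_ring_1^'c^'r \<Rightarrow> 'a" where
  "minor k f g M =
     (\<Sum>\<pi> | \<pi> permutes {..<k}. of_int (sign \<pi>) * (\<Prod>i<k. M $ f i $ g (\<pi> i)))"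

definition determinantal_divisor :: "nat \<Rightarrow> complex poly^'c^'r \<Rightarrow> complex poly" where
  "determinantal_divisor k P =
     Gcd {minor k f g P | f g. inj_on f {..<k} \<and> inj_on g {..<k}}"

text \<open>The \<open>k\<close>-th invariant polynomial is the quotient of the determinantal divisors of order \<open>k\<close>
  and \<open>k - 1\<close>, so the product of all of them is the determinantal divisor whose order is the
  normal rank. The algebraic multiplicity of \<open>z\<close>, i.e. the degree of the product of the elementary
  divisors at \<open>z\<close>, is the multiplicity of \<open>z\<close> as a root of this product; the geometric
  multiplicity is the rank deficiency at \<open>z\<close>, i.e. the number of elementary divisors at \<open>z\<close>.\<close>

definition zero_algebraic_multiplicity ::
  "real^'n^'n \<Rightarrow> real^'m^'n \<Rightarrow> real^'n^'p \<Rightarrow> real^'m^'p \<Rightarrow> complex \<Rightarrow> nat" where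
  "zero_algebraic_multiplicity A B C D z =
     order z (determinantal_divisor (normal_rank (system_pencil A B C D)) (system_pencil A B C D))"

definition zero_geometric_multiplicity ::
  "real^'n^'n \<Rightarrow> real^'m^'n \<Rightarrow> real^'n^'p \<Rightarrow> real^'m^'p \<Rightarrow> complex \<Rightarrow> nat" where
  "zero_geometric_multiplicity A B C D z =
     normal_rank (system_pencil A B C D) - rank (eval_matrix (system_pencil A B C D) z)"


section \<open>Properties of systems and subspaces\<close>

definition right_invertible ::
  "real^'n^'n \<Rightarrow> real^'m^'n \<Rightarrow> real^'n^'p \<Rightarrow> real^'m^'p \<Rightarrow> bool" where
  "right_invertible A B C D \<longleftrightarrow>
     finite {z. rank (eval_matrix (system_pencil A B C D) z) \<noteq> CARD('n) + CARD('p)}"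

definition stabilizable :: "time_domain \<Rightarrow> real^'n^'n \<Rightarrow> real^'m^'n \<Rightarrow> bool" where
  "stabilizable \<tau> A B \<longleftrightarrow> (\<exists>F :: real^'n^'m. spectrum (A + B ** F) \<subseteq> stability_region \<tau>)"

definition stabilizability_output_nulling ::
  "time_domain \<Rightarrow> real^'n^'n \<Rightarrow> real^'m^'n \<Rightarrow> real^'n^'p \<Rightarrow> real^'m^'p \<Rightarrow> (real^'n) set \<Rightarrow> bool" where
  "stabilizability_output_nulling \<tau> A B C D V \<longleftrightarrow>
     subspace V \<and>
     (\<exists>F :: real^'n^'m.
        (\<forall>v\<in>V. (A + B ** F) *v v \<in> V) \<and>
        (\<forall>v\<in>V. (C + D ** F) *v v = 0) \<and>
        spectrum_on (A + B ** F) V \<subseteq> stability_region \<tau>)"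

definition Vstar_g ::
  "time_domain \<Rightarrow> real^'n^'n \<Rightarrow> real^'m^'n \<Rightarrow> real^'n^'p \<Rightarrow> real^'m^'p \<Rightarrow> (real^'n) set" where
  "Vstar_g \<tau> A B C D = (GREATEST V. stabilizability_output_nulling \<tau> A B C D V)"

definition R_sub ::
  "real^'n^'n \<Rightarrow> real^'m^'n \<Rightarrow> real^'n^'p \<Rightarrow> real^'m^'p \<Rightarrow> 'p \<Rightarrow> real \<Rightarrow> (real^'n) set" where
  "R_sub A B C D i \<mu> =
     {v. \<exists>w :: real^'m. (A - \<mu> *\<^sub>R mat 1) *v v + B *v w = 0 \<and>
           (\<forall>k. k \<noteq> i \<longrightarrow> (C *v v + D *v w) $ k = 0)}"


section \<open>The decoupling problem\<close>

definition static_gain ::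
  "time_domain \<Rightarrow> real^'n^'n \<Rightarrow> real^'m^'n \<Rightarrow> real^'n^'p \<Rightarrow> real^'m^'p \<Rightarrow> real^'n^'m \<Rightarrow> real^'m^'p" where
  "static_gain \<tau> A B C D F =
     (C + D ** F) **
       matrix_inv (case \<tau> of Continuous \<Rightarrow> - (A + B ** F) | Discrete \<Rightarrow> mat 1 - (A + B ** F)) ** B + D"

definition tracks_constant_references ::
  "time_domain \<Rightarrow> real^'n^'n \<Rightarrow> real^'m^'n \<Rightarrow> real^'n^'p \<Rightarrow> real^'m^'p
     \<Rightarrow> real^'n^'m \<Rightarrow> real^'p^'m \<Rightarrow> bool" where
  "tracks_constant_references \<tau> A B C D F G \<longleftrightarrow>
     (\<forall>(rbar :: real^'p) (x :: real \<Rightarrow> real^'n) (u :: real \<Rightarrow> real^'m) (y :: real \<Rightarrow> real^'p).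
        (\<forall>t. u t = F *v x t + G *v rbar) \<longrightarrow>
        (\<forall>t. y t = C *v x t + D *v u t) \<longrightarrow>
        evolves \<tau> x (\<lambda>t. A *v x t + B *v u t) \<longrightarrow>
        (y \<longlongrightarrow> rbar) (time_at_top \<tau>))"

text \<open>In the following, \<open>\<nu> i\<close> is the number of modes in the \<open>i\<close>-th error component and \<open>\<mu> i j\<close>
  (\<open>1 \<le> j \<le> \<nu> i\<close>) are these modes.\<close>

definition state_to_output_decoupled ::
  "time_domain \<Rightarrow> real^'n^'n \<Rightarrow> real^'m^'n \<Rightarrow> real^'n^'p \<Rightarrow> real^'m^'p \<Rightarrow> real^'n^'m
     \<Rightarrow> ('p \<Rightarrow> nat) \<Rightarrow> ('p \<Rightarrow> nat \<Rightarrow> real) \<Rightarrow> bool" where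
  "state_to_output_decoupled \<tau> A B C D F \<nu> \<mu> \<longleftrightarrow>
     (let error_trajectory = (\<lambda>\<xi> :: real \<Rightarrow> real^'n. evolves \<tau> \<xi> (\<lambda>t. (A + B ** F) *v \<xi> t));
          has_modes = (\<lambda>\<xi> (\<beta> :: 'p \<Rightarrow> nat \<Rightarrow> real). \<forall>i. \<forall>t\<in>time_set \<tau>.
            ((C + D ** F) *v \<xi> t) $ i = (\<Sum>j = 1..\<nu> i. \<beta> i j * mode \<tau> (\<mu> i j) t))
      in (\<forall>\<xi>. error_trajectory \<xi> \<longrightarrow> (\<exists>\<beta>. has_modes \<xi> \<beta>)) \<and>
         (\<forall>\<beta>. \<exists>\<xi>. error_trajectory \<xi> \<and> has_modes \<xi> \<beta>))"

text \<open>The eigenvector basis is indexed by pairs: \<open>(Some i, j)\<close> for the modes observable from the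
  \<open>i\<close>-th error component, and \<open>(None, j)\<close> for the unobservable ones, whose eigenvalues \<open>\<mu>0 j\<close> are
  not prescribed. Eigenvalues are counted with multiplicity, so repetitions among the \<open>\<mu> i j\<close>
  are allowed.\<close>

definition mode_index :: "nat \<Rightarrow> ('p \<Rightarrow> nat) \<Rightarrow> ('p option \<times> nat) set" where
  "mode_index \<nu>0 \<nu> = (SIGMA k : UNIV. {1..(case k of None \<Rightarrow> \<nu>0 | Some i \<Rightarrow> \<nu> i)})"

definition has_decoupling_eigenbasis ::
  "real^'n^'n \<Rightarrow> real^'m^'n \<Rightarrow> real^'n^'p \<Rightarrow> real^'m^'p \<Rightarrow> real^'n^'m
     \<Rightarrow> nat \<Rightarrow> ('p \<Rightarrow> nat) \<Rightarrow> ('p \<Rightarrow> nat \<Rightarrow> real) \<Rightarrow> bool" where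
  "has_decoupling_eigenbasis A B C D F \<nu>0 \<nu> \<mu> \<longleftrightarrow>
     (\<exists>(\<mu>0 :: nat \<Rightarrow> real) (v :: 'p option \<times> nat \<Rightarrow> real^'n).
        inj_on v (mode_index \<nu>0 \<nu>) \<and>
        independent (v ` mode_index \<nu>0 \<nu>) \<and> span (v ` mode_index \<nu>0 \<nu>) = UNIV \<and>
        (\<forall>j\<in>{1..\<nu>0}.
           (A + B ** F) *v v (None, j) = \<mu>0 j *\<^sub>R v (None, j) \<and>
           (C + D ** F) *v v (None, j) = 0) \<and>
        (\<forall>i. \<forall>j\<in>{1..\<nu> i}.
           (A + B ** F) *v v (Some i, j) = \<mu> i j *\<^sub>R v (Some i, j) \<and>
           (\<exists>c. c \<noteq> 0 \<and> (C + D ** F) *v v (Some i, j) = c *\<^sub>R axis i 1)))"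

definition problem_1B_solvable ::
  "time_domain \<Rightarrow> real^'n^'n \<Rightarrow> real^'m^'n \<Rightarrow> real^'n^'p \<Rightarrow> real^'m^'p
     \<Rightarrow> ('p \<Rightarrow> nat) \<Rightarrow> ('p \<Rightarrow> nat \<Rightarrow> real) \<Rightarrow> bool" where
  "problem_1B_solvable \<tau> A B C D \<nu> \<mu> \<longleftrightarrow>
     (\<exists>(F :: real^'n^'m) (G :: real^'p^'m).
        spectrum (A + B ** F) \<subseteq> stability_region \<tau> \<and>
        static_gain \<tau> A B C D F ** G = mat 1 \<and>
        tracks_constant_references \<tau> A B C D F G \<and>
        state_to_output_decoupled \<tau> A B C D F \<nu> \<mu> \<and>
        has_decoupling_eigenbasis A B C D F (CARD('n) - (\<Sum>i\<in>UNIV. \<nu> i)) \<nu> \<mu>)"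

end

theory Submission
  imports Defs "HOL-Computational_Algebra.Fundamental_Theorem_Algebra"
begin

text \<open>The key is that \<open>V\<^sup>\<star>\<^sub>g\<close> is spanned by the vectors \<open>v\<close> for which \<open>(A - l I) v + B w = 0\<close> and
  \<open>C v + D w = 0\<close> for some \<open>w\<close> and some stable real \<open>l\<close>. Let \<open>\<psi>\<close> be a functional that vanishes on all
  these \<open>v\<close>. Then \<open>(\<psi>, 0)\<close> is in the row space of the system pencil \<open>P(l)\<close> for every stable real \<open>l\<close>,
  so that \<open>q(s) P(s) = \<delta>(s) (\<psi>, 0)\<close> for some polynomials \<open>q\<close> and \<open>\<delta> \<noteq> 0\<close>. Because the minimum-phase
  zeros are real and semisimple, \<open>\<delta>\<close> can be chosen without stable roots. On a subspace \<open>V\<close> that is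
  invariant under \<open>M = A + B F\<close> and contained in the kernel of \<open>C + D F\<close> this says
  \<open>q(s) (M - s) v = \<delta>(s) \<psi>(v)\<close>, hence \<open>\<psi>(\<delta>(M) v) = 0\<close>; if the spectrum of \<open>M\<close> on \<open>V\<close> is
  stable, \<open>\<delta>(M)\<close> is invertible on \<open>V\<close> and \<open>\<psi>\<close> vanishes on \<open>V\<close>.

  Given this description of \<open>V\<^sup>\<star>\<^sub>g\<close>, the dimension inequalities are the conditions of Rado's theorem for a
  linearly independent choice of one vector from each \<open>R\<^sub>i(\<mu>\<^sub>i\<^sub>j)\<close> and \<open>\<nu>\<^sub>0\<close> vectors from \<open>V\<^sup>\<star>\<^sub>g\<close>. Rado's
  theorem is applied to spanning sets of these spaces that contain only admissible closed-loop
  eigenvectors, so the chosen vectors determine the feedback.\<close>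

subsection \<open>Minors and left kernels\<close>

text \<open>\<open>minor\<close> sums over permutations of the numbers below
  \<open>CARD('r)\<close>, \<open>det\<close> over permutations of the row type. As \<open>f\<close>
  is a bijection between the two, conjugation with \<open>f\<close> matches the permutations and
  keeps their signs; the price is that the columns are read along the inverse of
  \<open>f\<close>.\<close>

lemma minor_eq_det:
  fixes P :: "'a::comm_ring_1^'c^'r"
  assumes f: "inj_on f {..<CARD('r)}"
  shows "minor (CARD('r)) f g P = det (\<chi> r c. P $ r $ g (the_inv_into {..<CARD('r)} f c))"
proof -
  let ?K = "{..<CARD('r)}"
  have img: "f ` ?K = UNIV"
    using f by (intro card_subset_eq) (auto simp: card_image)
  have bij: "bij_betw f ?K UNIV"
    using f img by (simp add: bij_betw_def)
  define h where "h = the_inv_into ?K f"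
  have hf: "h (f i) = i" if "i \<in> ?K" for i
    using the_inv_into_f_f[OF f that] by (simp add: h_def)
  have invf: "inv_into ?K f (f i) = i" if "i \<in> ?K" for i
    using f that by (rule inv_into_f_f)
  have fh: "f (h c) = c" "h c \<in> ?K" for c
  proof -
    have "c \<in> f ` ?K" using img by simp
    then obtain i where "i \<in> ?K" "c = f i" by blast
    then show "f (h c) = c" "h c \<in> ?K" using hf by simp_all
  qed
  have bijh: "bij_betw h UNIV ?K"
    by (rule bij_betw_byWitness[where f' = f]) (use fh hf in auto)
  have mp: "map_permutation ?K f p c = f (p (h c))" for p c
    unfolding map_permutation_def restrict_id_def using img invf[of "h c"] fh[of c] by simp
  have mph: "map_permutation UNIV h p i = h (p (f i))" if "i \<in> ?K" for p i
  proof -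
    have "inj h" "i \<in> range h" using bijh that by (auto simp: bij_betw_def)
    moreover have "inv h i = f i" using \<open>inj h\<close> hf[OF that] by (metis inv_f_f)
    ultimately show ?thesis by (simp add: map_permutation_def restrict_id_def)
  qed
  show ?thesis
    unfolding minor_def det_def h_def[symmetric]
  proof (rule sum.reindex_bij_witness[where i = "map_permutation UNIV h" and j = "map_permutation ?K f"])
    fix p assume "p \<in> {\<pi>. \<pi> permutes ?K}"
    then have p: "p permutes ?K" by simp
    then show "map_permutation ?K f p \<in> {p. p permutes UNIV}"
      using map_permutation_permutes[OF bij] by simp
    show "map_permutation UNIV h (map_permutation ?K f p) = p"
    proof
      fix i
      show "map_permutation UNIV h (map_permutation ?K f p) i = p i"
      proof (cases "i \<in> ?K")
        case True
        moreover have "p i \<in> ?K" using permutes_in_image[OF p] True by simp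
        ultimately show ?thesis by (simp add: mph mp hf)
      next
        case False
        then have "i \<notin> range h" using bijh by (auto simp: bij_betw_def)
        then show ?thesis using False p by (simp add: map_permutation_def restrict_id_def permutes_not_in)
      qed
    qed
    have "(\<Prod>r\<in>UNIV. (\<chi> r c. P $ r $ g (h c)) $ r $ map_permutation ?K f p r)
      = (\<Prod>i\<in>?K. P $ f i $ g (p i))"
    proof (rule prod.reindex_bij_betw[OF bij, symmetric, THEN trans], rule prod.cong)
      fix i assume i: "i \<in> ?K"
      then have "p i \<in> ?K" using permutes_in_image[OF p] by simp
      with i show "(\<chi> r c. P $ r $ g (h c)) $ f i $ map_permutation ?K f p (f i) = P $ f i $ g (p i)"
        by (simp add: mp hf)
    qed simp
    then show "of_int (sign (map_permutation ?K f p)) *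
          (\<Prod>i\<in>UNIV. (\<chi> r c. P $ r $ g (h c)) $ i $ map_permutation ?K f p i) =
         of_int (sign p) * (\<Prod>i<CARD('r). P $ f i $ g (p i))"
      by (simp add: sign_map_permutation[OF f p])
  next
    fix p assume "p \<in> {\<pi>. \<pi> permutes (UNIV::'r set)}"
    then have p: "p permutes UNIV" by simp
    then show q: "map_permutation UNIV h p \<in> {\<pi>. \<pi> permutes ?K}"
      using map_permutation_permutes[OF bijh] by simp
    show "map_permutation ?K f (map_permutation UNIV h p) = p"
      using fh by (auto simp: fun_eq_iff mp mph)
  qed
qed

lemma poly_det: "poly (det M) z = det (\<chi> i j. poly (M $ i $ j) z)"
  for M :: "'a::comm_ring_1 poly^'n^'n"
  by (simp add: det_def poly_sum poly_prod)

text \<open>Indexing a basis of the whole space by the row type itself makes it usable as the rows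
  or columns of a square matrix.\<close>

lemma basis_enumeration:
  fixes E :: "('a::field^'r) set"
  assumes E: "vec.independent E" "UNIV \<subseteq> vec.span E"
  obtains e :: "'r \<Rightarrow> 'a^'r" where "bij_betw e UNIV E"
    "\<And>u i. (\<Sum>i\<in>UNIV. u i *s e i) = 0 \<Longrightarrow> u i = 0"
proof -
  have fin: "finite E" using E(1) by (rule vec.finiteI_independent)
  have "card E = CARD('r)"
    using vec.basis_card_eq_dim[of E UNIV] E by (simp add: card_cart_basis)
  then obtain e where e: "bij_betw e (UNIV::'r set) E"
    using fin by (metis finite_class.finite_UNIV finite_same_card_bij)
  then have inj: "inj e" and E_eq: "E = range e" by (auto simp: bij_betw_def)
  have "u i = 0" if "(\<Sum>i\<in>UNIV. u i *s e i) = 0" for u :: "'r \<Rightarrow> 'a" and i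
  proof -
    have "(\<Sum>v\<in>E. u (inv e v) *s v) = 0"
      unfolding E_eq using that by (subst sum.reindex[OF inj]) (simp add: inj)
    then have "u (inv e (e i)) = 0"
      using E(1) unfolding vec.dependent_finite[OF fin] by (auto simp: E_eq)
    then show ?thesis by (simp add: inj)
  qed
  with e show ?thesis by (rule that)
qed

text \<open>\<open>rows N\<close> is a set, in which equal rows collapse. The rank therefore gives
  two things: a cardinality count shows that the rows are pairwise distinct, and then that they are
  linearly independent.\<close>

lemma left_kernel_trivial:
  fixes N :: "'a::field^'c^'r"
  assumes rank: "rank N = CARD('r)" and q: "\<And>c. (\<Sum>r\<in>UNIV. q r * N $ r $ c) = 0"
  shows "q r = 0"
proof -
  have rows: "rows N = range (\<lambda>i. row i N)" by (auto simp: rows_def)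
  have fin: "finite (rows N)" by (simp add: rows)
  have "card (rows N) \<le> CARD('r)" unfolding rows by (simp add: card_image_le)
  moreover have "vec.dim (rows N) \<le> card (rows N)"
    by (rule vec.dim_le_card) (auto simp: fin vec.span_base)
  ultimately have card: "card (rows N) = CARD('r)" "card (rows N) = vec.dim (rows N)"
    using rank by (auto simp: row_rank_def_gen)
  have inj: "inj (\<lambda>i. row i N)"
    using card(1) unfolding rows by (intro eq_card_imp_inj_on) auto
  have ind: "vec.independent (rows N)"
    using card(2) fin vec.card_eq_dim[of "rows N" "rows N"] vec.span_superset by auto
  define u where "u = (\<lambda>v. q (inv (\<lambda>i. row i N) v))"
  have "(\<Sum>v\<in>rows N. u v *s v) = (\<Sum>i\<in>UNIV. q i *s row i N)"
    unfolding rows by (subst sum.reindex[OF inj]) (simp add: u_def inv_f_f[OF inj])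
  also have "\<dots> = 0" using q by (simp add: vec_eq_iff row_def)
  finally have "u (row r N) = 0"
    using ind fin unfolding vec.dependent_finite[OF fin] by (auto simp: rows)
  then show ?thesis by (simp add: u_def inv_f_f[OF inj])
qed

text \<open>This is rank-nullity for the left kernel, with a basis forced to contain
  \<open>q\<close>. A basis \<open>R\<close> of the row space is lifted through
  \<open>k v* N\<close> by \<open>g\<close>; the kernel basis \<open>K\<close> and the lifts
  together span the whole space, and counting them bounds \<open>card K\<close> from below.\<close>

lemma left_kernel_basis:
  fixes N :: "'a::field^'c^'r"
  assumes q: "\<And>c. (\<Sum>r\<in>UNIV. q $ r * N $ r $ c) = 0" and "q \<noteq> 0"
  obtains K where "q \<in> K" "vec.independent K" "CARD('r) - rank N \<le> card K"
    "\<And>k c. k \<in> K \<Longrightarrow> (\<Sum>r\<in>UNIV. k $ r * N $ r $ c) = 0"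
proof -
  define L where "L = (\<lambda>k. k v* N)"
  have L: "L k = 0 \<longleftrightarrow> (\<forall>c. (\<Sum>r\<in>UNIV. k $ r * N $ r $ c) = 0)" for k
    by (simp add: L_def vector_matrix_mult_def vec_eq_iff mult.commute)
  have L_linear: "Vector_Spaces.linear (*s) (*s) L"
    by unfold_locales (simp_all add: L_def vector_matrix_mult_def vec_eq_iff algebra_simps
        sum.distrib sum_distrib_left)
  have diff: "L (x - y) = L x - L y" for x y
    by (rule vec.linear_diff[OF L_linear])
  have axis: "L (axis i 1) = row i N" for i
    by (simp add: L_def vector_matrix_mult_def vec_eq_iff row_def axis_def if_distrib if_distribR cong: if_cong)
  have indq: "vec.independent {q}" using \<open>q \<noteq> 0\<close> by simp
  have qk: "{q} \<subseteq> {k. L k = 0}" using q by (simp add: L)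
  obtain K where K: "{q} \<subseteq> K" "K \<subseteq> {k. L k = 0}" "vec.independent K" "{k. L k = 0} \<subseteq> vec.span K"
    using vec.maximal_independent_subset_extend[OF qk indq] by blast
  obtain R where R: "R \<subseteq> rows N" "vec.independent R" "rows N \<subseteq> vec.span R" "card R = rank N"
    using vec.basis_exists[of "rows N"] unfolding row_rank_def_gen by blast
  have "\<forall>b\<in>R. \<exists>k. L k = b" using R(1) axis by (force simp: rows_def)
  then obtain g where g: "\<And>b. b \<in> R \<Longrightarrow> L (g b) = b" by metis
  have fin: "finite K" "finite R" using K R vec.finiteI_independent by auto
  have "UNIV \<subseteq> vec.span (K \<union> g ` R)"
  proof
    fix k :: "'a^'r"
    have "k = (\<Sum>i\<in>UNIV. k $ i *s axis i 1)" by (rule basis_expansion[symmetric])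
    then have "L k = (\<Sum>i\<in>UNIV. k $ i *s row i N)"
      by (metis (no_types, lifting) L_linear axis sum.cong vec.linear_scale vec.linear_sum)
    moreover have "row i N \<in> vec.span (rows N)" for i
      by (rule vec.span_base) (auto simp: rows_def)
    ultimately have "L k \<in> vec.span (rows N)"
      by (simp add: vec.span_sum vec.span_scale)
    then have "L k \<in> vec.span R"
      using R(3) by (meson subsetD vec.span_minimal vec.subspace_span)
    moreover have "L ` g ` R = R" using g by (force simp: image_iff)
    ultimately have "L k \<in> L ` vec.span (g ` R)"
      by (simp add: vec.linear_span_image[OF L_linear, symmetric])
    then obtain y where y: "y \<in> vec.span (g ` R)" "L k = L y" by blast
    then have "k - y \<in> vec.span K" using K(4) diff[of k y] by auto
    moreover have "vec.span K \<subseteq> vec.span (K \<union> g ` R)" "vec.span (g ` R) \<subseteq> vec.span (K \<union> g ` R)"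
      by (auto intro!: vec.span_mono)
    ultimately show "k \<in> vec.span (K \<union> g ` R)"
      using y vec.span_add[of "k - y" "K \<union> g ` R" y] by auto
  qed
  then have "CARD('r) \<le> card (K \<union> g ` R)"
    using vec.dim_le_card[of UNIV "K \<union> g ` R"] fin by (simp add: card_cart_basis)
  also have "\<dots> \<le> card K + card R"
    using card_Un_le[of K "g ` R"] card_image_le[OF fin(2), of g] by linarith
  finally have "CARD('r) - rank N \<le> card K" using R(4) by simp
  then show ?thesis using that[of K] K L by auto
qed

lemma linear_power_dvd_cancel:
  fixes a b :: "complex poly"
  assumes "[:-z, 1:] ^ k dvd a * b" and "poly a z \<noteq> 0"
  shows "[:-z, 1:] ^ k dvd b"
proof -
  have "coprime [:-z, 1:] a"
    using assms(2) by (intro prime_elem_imp_coprime prime_elem_linear_field_poly)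
      (auto simp: poly_eq_0_iff_dvd[symmetric])
  then have "coprime ([:-z, 1:] ^ k) a" by simp
  with assms(1) show ?thesis by (simp add: coprime_dvd_mult_right_iff)
qed

text \<open>The left kernel of \<open>P(z)\<close> has dimension at least the rank deficiency \<open>d\<close> of \<open>P(z)\<close>. Multiplying
  a square submatrix from the left by a constant basis of \<open>\<complex>\<^sup>r\<close> adapted to this kernel, in which the
  vector \<open>q(z)\<close> is replaced by \<open>q(s)\<close>, yields \<open>d\<close> rows that vanish at \<open>z\<close>, one of them to second
  order.\<close>

lemma minor_dvd:
  fixes P :: "complex poly^'c^'r" and q :: "complex poly^'r"
  assumes q: "\<And>c. [:-z, 1:]\<^sup>2 dvd (\<Sum>r\<in>UNIV. q $ r * P $ r $ c)"
    and qz: "poly (q $ r0) z \<noteq> 0" and f: "inj_on f {..<CARD('r)}"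
  shows "[:-z, 1:] ^ Suc (CARD('r) - rank (eval_matrix P z)) dvd minor (CARD('r)) f g P"
proof -
  define N where "N = eval_matrix P z"
  define q0 where "q0 = (\<chi> r. poly (q $ r) z)"
  have N: "N $ r $ c = poly (P $ r $ c) z" for r c by (simp add: N_def eval_matrix_def)
  have "q0 \<noteq> 0" using qz by (auto simp: q0_def vec_eq_iff)
  moreover have "(\<Sum>r\<in>UNIV. q0 $ r * N $ r $ c) = 0" for c
  proof -
    have "[:-z, 1:] dvd (\<Sum>r\<in>UNIV. q $ r * P $ r $ c)"
      by (rule dvd_trans[OF dvd_power q]) simp
    then show ?thesis by (simp add: poly_eq_0_iff_dvd[symmetric] poly_sum q0_def N)
  qed
  ultimately obtain K where K: "q0 \<in> K" "vec.independent K" "CARD('r) - rank N \<le> card K"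
    and Kker: "\<And>k c. k \<in> K \<Longrightarrow> (\<Sum>r\<in>UNIV. k $ r * N $ r $ c) = 0"
    using left_kernel_basis[of q0 N] by blast
  obtain E where E: "K \<subseteq> E" "vec.independent E" "UNIV \<subseteq> vec.span E"
    using vec.maximal_independent_subset_extend[OF subset_UNIV K(2)] by metis
  have finE: "finite E" using E(2) by (rule vec.finiteI_independent)
  obtain e where e: "bij_betw e (UNIV::'r set) E"
    and e_ind: "\<And>u i. (\<Sum>i\<in>UNIV. u i *s e i) = 0 \<Longrightarrow> u i = 0"
    using basis_enumeration[OF E(2,3)] by metis
  define ip where "ip = inv e q0"
  have eip: "e i = q0 \<longleftrightarrow> i = ip" for i
    using e E K by (auto simp: ip_def bij_betw_def inj_def f_inv_into_f)
  \<comment> \<open>Only row \<open>ip\<close> is a nonconstant polynomial. At \<open>z\<close> it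
    agrees with \<open>e ip\<close>, so \<open>T\<close> evaluated at \<open>z\<close> has a basis
    as its rows and is invertible.\<close>
  define T :: "complex poly^'r^'r" where "T = (\<chi> i r. if i = ip then q $ r else [:e i $ r:])"
  define M where "M = (\<chi> r c. P $ r $ g (the_inv_into {..<CARD('r)} f c))"
  have Tz: "(\<chi> i r. poly (T $ i $ r) z) = (\<chi> i. e i)"
    using eip[of ip] by (auto simp: vec_eq_iff T_def q0_def)
  have "poly (det T) z \<noteq> 0"
  proof -
    have rows: "row i (\<chi> i. e i) = e i" for i by (simp add: row_def vec_eq_iff)
    have "invertible ((\<chi> i. e i) :: complex^'r^'r)"
      unfolding invertible_right_inverse matrix_right_invertible_independent_rows rows
      using e_ind by blast
    then show ?thesis by (simp add: poly_det Tz invertible_det_nz)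
  qed
  moreover
  \<comment> \<open>\<open>c i\<close> is the factor that can be extracted from row \<open>i\<close>
    of \<open>T ** M\<close>: second order for the row of \<open>q\<close>, first order for the
    other rows in the left kernel, none for the rest.\<close>
  define c where "c i = (if i = ip then [:-z, 1:]\<^sup>2 else if e i \<in> K then [:-z, 1:] else 1)" for i
  define R where "R i j = (T ** M) $ i $ j div c i" for i j
  have R: "(T ** M) $ i $ j = c i * R i j" for i j
  proof -
    have "c i dvd (T ** M) $ i $ j"
    proof (cases "i = ip")
      case True
      then show ?thesis using q by (simp add: c_def matrix_matrix_mult_def T_def M_def)
    next
      case False
      show ?thesis
      proof (cases "e i \<in> K")
        case True
        have "poly ((T ** M) $ i $ j) z = 0"
          using False Kker[OF True]
          by (simp add: matrix_matrix_mult_def T_def M_def poly_sum N)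
        then show ?thesis using True False by (simp add: c_def poly_eq_0_iff_dvd)
      qed (simp add: c_def False)
    qed
    then show ?thesis by (simp add: R_def)
  qed
  have "T ** M = (\<chi> i. c i *s (\<chi> j. R i j))" by (simp add: vec_eq_iff R)
  then have "det (T ** M) = (\<Prod>i\<in>UNIV. c i) * det (\<chi> i j. R i j)"
    by (simp add: det_rows_mul)
  moreover have "(\<Prod>i\<in>UNIV. c i) = [:-z, 1:] ^ Suc (card K)"
  proof -
    have ip: "ip \<in> e -` K" using eip[of ip] K(1) by simp
    have cK: "card (e -` K) = card K"
      by (rule bij_betw_same_card[of e]) (use e E(1) in \<open>auto simp: bij_betw_def inj_on_def image_iff\<close>)
    have "(\<Prod>i\<in>UNIV. c i) = (\<Prod>i\<in>e -` K. c i)"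
      by (rule prod.mono_neutral_right) (use ip in \<open>auto simp: c_def\<close>)
    also have "\<dots> = c ip * (\<Prod>i\<in>e -` K - {ip}. c i)"
      using ip by (simp add: prod.remove)
    also have "(\<Prod>i\<in>e -` K - {ip}. c i) = (\<Prod>i\<in>e -` K - {ip}. [:-z, 1:])"
      by (rule prod.cong) (auto simp: c_def)
    also have "\<dots> = [:-z, 1:] ^ (card K - 1)" using ip cK by simp
    also have "c ip * \<dots> = [:-z, 1:] ^ (2 + (card K - 1))" by (simp only: c_def power_add if_True simp_thms)
    \<comment> \<open>The subtraction is truncated, so this needs \<open>K\<close> to be nonempty,
      which holds because \<open>q0\<close> is in \<open>K\<close>.\<close>
    also have "2 + (card K - 1) = Suc (card K)"
    proof -
      have "card K \<noteq> 0" using K(1) finE E(1) finite_subset by (metis card_0_eq empty_iff)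
      then show ?thesis by simp
    qed
    finally show ?thesis .
  qed
  ultimately have "det T * det M = [:-z, 1:] ^ Suc (card K) * det (\<chi> i j. R i j)"
    by (simp only: det_mul)
  \<comment> \<open>\<open>det T\<close> does not vanish at \<open>z\<close> and hence absorbs no
    factor \<open>s - z\<close>.\<close>
  then have "[:-z, 1:] ^ Suc (card K) dvd det M"
    using \<open>poly (det T) z \<noteq> 0\<close> by (metis dvd_triv_left linear_power_dvd_cancel)
  then have "[:-z, 1:] ^ Suc (CARD('r) - rank N) dvd det M"
    by (rule dvd_trans[OF le_imp_power_dvd, rotated]) (use K(3) in simp)
  then show ?thesis unfolding minor_eq_det[OF f] M_def N_def .
qed

text \<open>A row \<open>q\<close> with \<open>q(z)\<close> nonzero for which \<open>q P\<close>
  vanishes to second order at \<open>z\<close> is a left Jordan chain of length two. By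
  \<open>minor_dvd\<close> it would force every maximal minor, and so their gcd, to have a zero at
  \<open>z\<close> of order exceeding the rank deficiency.\<close>

lemma semisimple_zero_no_left_chain:
  fixes P :: "complex poly^'c^'r" and q :: "complex poly^'r"
  assumes nz: "determinantal_divisor (CARD('r)) P \<noteq> 0"
    and ord: "order z (determinantal_divisor (CARD('r)) P) = CARD('r) - rank (eval_matrix P z)"
    and q: "\<And>c. [:-z, 1:]\<^sup>2 dvd (\<Sum>r\<in>UNIV. q $ r * P $ r $ c)"
  shows "poly (q $ r) z = 0"
proof (rule ccontr)
  assume *: "poly (q $ r) z \<noteq> 0"
  have "[:-z, 1:] ^ Suc (CARD('r) - rank (eval_matrix P z)) dvd determinantal_divisor (CARD('r)) P"
    unfolding determinantal_divisor_def 
  proof (rule Gcd_greatest, elim CollectE exE conjE, hypsubst)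
    fix f :: "nat \<Rightarrow> 'r" and g
    assume f: "inj_on f {..<CARD('r)}"
    show "[:-z, 1:] ^ Suc (CARD('r) - rank (eval_matrix P z)) dvd minor (CARD('r)) f g P"
      by (rule minor_dvd[OF q * f])
  qed
  then show False unfolding order_divides using nz ord by simp
qed

lemma determinantal_divisor_nonzero:
  fixes P :: "complex poly^'c^'r"
  assumes "inj g" and "det (\<chi> r c. P $ r $ g c) \<noteq> 0"
  shows "determinantal_divisor (CARD('r)) P \<noteq> 0"
proof -
  obtain f where f: "bij_betw f {..<CARD('r)} (UNIV::'r set)"
    by (metis card_lessThan finite_class.finite_UNIV finite_lessThan finite_same_card_bij)
  then have inj: "inj_on f {..<CARD('r)}" by (rule bij_betw_imp_inj_on)
  have fc: "f (the_inv_into {..<CARD('r)} f c) = c" for c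
    using f by (metis UNIV_I bij_betw_def f_the_inv_into_f)
  \<comment> \<open>Composing the column choice with \<open>f\<close> undoes the reordering in
    \<open>minor_eq_det\<close>, so that exactly the given determinant appears.\<close>
  have "minor (CARD('r)) f (g \<circ> f) P \<noteq> 0"
    using assms(2) by (simp add: minor_eq_det[OF inj] fc)
  moreover have "determinantal_divisor (CARD('r)) P dvd minor (CARD('r)) f (g \<circ> f) P"
    unfolding determinantal_divisor_def
    using inj comp_inj_on[OF inj inj_on_subset[OF assms(1) subset_UNIV]]
    by (intro Gcd_dvd CollectI exI[of _ f] exI[of _ "g \<circ> f"] conjI refl)
  ultimately show ?thesis by auto
qed

subsection \<open>Polynomial row combinations of a polynomial matrix\<close>

lemma poly_eq_if_infinite:
  fixes a b :: "'a::{idom,ring_char_0} poly"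
  assumes "infinite S" and "\<And>x. x \<in> S \<Longrightarrow> poly a x = poly b x"
  shows "a = b"
proof (rule ccontr)
  assume "a \<noteq> b"
  then have "finite {x. poly (a - b) x = 0}" by (intro poly_roots_finite) simp
  moreover have "S \<subseteq> {x. poly (a - b) x = 0}" using assms(2) by auto
  ultimately show False using assms(1) finite_subset by blast
qed

text \<open>Independent rows make the columns span the whole space; a basis chosen among the columns
  then has as many members as there are rows.\<close>

lemma full_rank_column_selection:
  fixes N :: "'a::field^'c^'r"
  assumes "rank N = CARD('r)"
  obtains g :: "'r \<Rightarrow> 'c" where "inj g" "det (\<chi> r c. N $ r $ g c) \<noteq> 0"
proof -
  have "\<forall>c. (\<Sum>i\<in>UNIV. c i *s row i N) = 0 \<longrightarrow> (\<forall>i. c i = 0)"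
    using left_kernel_trivial[OF assms] by (simp add: vec_eq_iff row_def)
  then have "vec.span (columns N) = UNIV"
    unfolding matrix_right_invertible_independent_rows[symmetric] matrix_right_invertible_span_columns .
  moreover obtain G where G: "G \<subseteq> columns N" "vec.independent G" "columns N \<subseteq> vec.span G"
    using vec.basis_exists[of "columns N"] by metis
  ultimately have span_G: "UNIV \<subseteq> vec.span G"
    using vec.span_minimal[OF G(3) vec.subspace_span] by simp
  obtain e where e: "bij_betw e (UNIV::'r set) G"
    and e_ind: "\<And>u i. (\<Sum>i\<in>UNIV. u i *s e i) = 0 \<Longrightarrow> u i = 0"
    using basis_enumeration[OF G(2) span_G] by metis
  then have inj: "inj e" and G_eq: "G = range e" by (auto simp: bij_betw_def)
  have "\<forall>i. \<exists>c. e i = column c N" using G(1) G_eq by (auto simp: columns_def)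
  then obtain g where g: "\<And>i. e i = column (g i) N" by metis
  have "inj g" using inj g by (metis injD injI)
  moreover have "column i (\<chi> r c. N $ r $ g c) = e i" for i
    by (simp add: column_def g vec_eq_iff)
  ultimately have "inj g" "invertible (\<chi> r c. N $ r $ g c)"
    unfolding invertible_left_inverse matrix_left_invertible_independent_columns using e_ind by auto
  then show ?thesis using that by (simp add: invertible_det_nz)
qed

text \<open>Cramer's rule with the denominator cleared: on the selected columns the coefficients
  \<open>\<eta>\<close> are quotients with denominator \<open>det M\<close>, and \<open>q\<close>
  collects the numerators. Each \<open>\<eta>\<close> solves the equations for all columns, so the
  polynomial identity holds at the infinitely many points of \<open>S\<close> for every
  column.\<close>

lemma polynomial_left_combination_exists:
  fixes P :: "complex poly^'c^'r" and \<psi> :: "complex^'c"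
  assumes g: "det (\<chi> r c. P $ r $ g c) \<noteq> 0"
    and inf: "infinite S"
    and S: "\<And>z. z \<in> S \<Longrightarrow> \<exists>\<eta>. \<forall>c. (\<Sum>r\<in>UNIV. \<eta> r * poly (P $ r $ c) z) = \<psi> $ c"
  obtains \<delta> q where "\<delta> \<noteq> 0" "\<And>c. (\<Sum>r\<in>UNIV. q $ r * P $ r $ c) = \<delta> * [:\<psi> $ c:]"
proof -
  define M where "M = (\<chi> r c. P $ r $ g c)"
  define q where "q = (\<chi> k. det (\<chi> i. if i = k then (\<chi> c. [:\<psi> $ g c:]) else row i M))"
  have "(\<Sum>r\<in>UNIV. q $ r * P $ r $ c) = det M * [:\<psi> $ c:]" for c
  proof (rule poly_eq_if_infinite[OF inf])
    fix z assume "z \<in> S"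
    then obtain \<eta> where \<eta>: "\<And>c. (\<Sum>r\<in>UNIV. \<eta> r * poly (P $ r $ c) z) = \<psi> $ c"
      using S by blast
    define N where "N = (\<chi> i j. poly (M $ i $ j) z)"
    have "poly (q $ k) z = \<eta> k * det N" for k
    proof -
      have *: "(\<Sum>i\<in>UNIV. (\<chi> i. \<eta> i) $ i *s row i N) = (\<chi> c. \<psi> $ g c)"
        using \<eta> by (simp add: vec_eq_iff row_def N_def M_def)
      have "poly (q $ k) z = det (\<chi> i. if i = k then (\<chi> c. \<psi> $ g c) else row i N)"
        unfolding q_def
        by (simp add: poly_det) (rule arg_cong[of _ _ det], simp add: vec_eq_iff N_def row_def)
      also have "\<dots> = \<eta> k * det N"
        using cramer_lemma_transpose[of k "\<chi> i. \<eta> i" N, unfolded *] by simp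
      finally show ?thesis .
    qed
    then have "poly (\<Sum>r\<in>UNIV. q $ r * P $ r $ c) z = det N * (\<Sum>r\<in>UNIV. \<eta> r * poly (P $ r $ c) z)"
      by (simp add: poly_sum sum_distrib_left algebra_simps)
    then show "poly (\<Sum>r\<in>UNIV. q $ r * P $ r $ c) z = poly (det M * [:\<psi> $ c:]) z"
      by (simp add: \<eta> poly_det N_def)
  qed
  moreover have "det M \<noteq> 0" using g by (simp add: M_def)
  ultimately show ?thesis by (rule that[rotated])
qed

text \<open>Among all polynomial representations \<open>q P = \<delta> \<psi>\<close>, one with \<open>\<delta>\<close> of least degree has no root
  in \<open>Z\<close>: at a root \<open>z\<close> also \<open>q\<close> would vanish, so that \<open>s - z\<close> could be cancelled.\<close>

lemma polynomial_left_combination_no_roots: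
  fixes P :: "complex poly^'c^'r" and \<psi> :: "complex^'c"
  assumes g: "inj g" "det (\<chi> r c. P $ r $ g c) \<noteq> 0"
    and inf: "infinite S"
    and S: "\<And>z. z \<in> S \<Longrightarrow> \<exists>\<eta>. \<forall>c. (\<Sum>r\<in>UNIV. \<eta> r * poly (P $ r $ c) z) = \<psi> $ c"
    and Z: "\<And>z. z \<in> Z \<Longrightarrow> rank (eval_matrix P z) \<noteq> CARD('r) \<Longrightarrow>
      order z (determinantal_divisor (CARD('r)) P) = CARD('r) - rank (eval_matrix P z) \<and>
      (\<exists>\<eta>. \<forall>c. (\<Sum>r\<in>UNIV. \<eta> r * poly (P $ r $ c) z) = \<psi> $ c)"
  obtains \<delta> q where "\<And>z. z \<in> Z \<Longrightarrow> poly \<delta> z \<noteq> 0"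
    "\<And>c. (\<Sum>r\<in>UNIV. q $ r * P $ r $ c) = \<delta> * [:\<psi> $ c:]"
proof -
  define good where "good \<delta> \<longleftrightarrow> \<delta> \<noteq> 0 \<and>
      (\<exists>q :: complex poly^'r. \<forall>c. (\<Sum>r\<in>UNIV. q $ r * P $ r $ c) = \<delta> * [:\<psi> $ c:])" for \<delta>
  obtain \<delta>0 where "good \<delta>0"
    using polynomial_left_combination_exists[OF g(2) inf S] unfolding good_def by metis
  then obtain \<delta> where \<delta>: "good \<delta>" and least: "\<And>\<delta>'. good \<delta>' \<Longrightarrow> degree \<delta> \<le> degree \<delta>'"
    using ex_has_least_nat[of good \<delta>0 degree] by blast
  then obtain q :: "complex poly^'r" where q: "\<And>c. (\<Sum>r\<in>UNIV. q $ r * P $ r $ c) = \<delta> * [:\<psi> $ c:]"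
    unfolding good_def by blast
  have "poly \<delta> z \<noteq> 0" if z: "z \<in> Z" for z
  proof
    assume root: "poly \<delta> z = 0"
    then obtain \<delta>' where \<delta>': "\<delta> = [:-z, 1:] * \<delta>'" unfolding poly_eq_0_iff_dvd by blast
    \<comment> \<open>At a point of full row rank, \<open>q(z)\<close> lies in a trivial left
      kernel. At the remaining points of \<open>Z\<close> the semisimplicity hypothesis takes
      over.\<close>
    have "poly (q $ r) z = 0" for r
    proof (cases "rank (eval_matrix P z) = CARD('r)")
      case True
      show ?thesis
      proof (rule left_kernel_trivial[OF True])
        fix c
        have "poly (\<Sum>r\<in>UNIV. q $ r * P $ r $ c) z = 0" by (simp only: q) (simp add: root)
        then show "(\<Sum>r\<in>UNIV. poly (q $ r) z * eval_matrix P z $ r $ c) = 0"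
          by (simp add: poly_sum eval_matrix_def)
      qed
    next
      case False
      then obtain \<eta> where ord: "order z (determinantal_divisor (CARD('r)) P) = CARD('r) - rank (eval_matrix P z)"
        and \<eta>: "\<And>c. (\<Sum>r\<in>UNIV. \<eta> r * poly (P $ r $ c) z) = \<psi> $ c"
        using Z[OF z] by blast
      \<comment> \<open>Subtracting \<open>\<delta> \<eta>\<close> with constant
        \<open>\<eta>\<close> does not change \<open>q(z)\<close>, since \<open>\<delta>\<close>
        vanishes at \<open>z\<close>, but raises the order of vanishing: the product with
        \<open>P\<close> becomes \<open>\<delta> (\<psi> - \<eta> P)\<close>, where both factors are
        zero at \<open>z\<close>.\<close>
      have "[:-z, 1:]\<^sup>2 dvd (\<Sum>r\<in>UNIV. (\<chi> r. q $ r - \<delta> * [:\<eta> r:]) $ r * P $ r $ c)" for c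
      proof -
        have eq: "(\<Sum>r\<in>UNIV. (\<chi> r. q $ r - \<delta> * [:\<eta> r:]) $ r * P $ r $ c)
          = \<delta> * ([:\<psi> $ c:] - (\<Sum>r\<in>UNIV. [:\<eta> r:] * P $ r $ c))"
          by (simp add: left_diff_distrib right_diff_distrib sum_subtractf q sum_distrib_left mult.assoc
              del: mult_pCons_right mult_pCons_left)
        have "poly ([:\<psi> $ c:] - (\<Sum>r\<in>UNIV. [:\<eta> r:] * P $ r $ c)) z = 0"
          by (simp add: poly_sum \<eta>)
        then have "[:-z, 1:] dvd [:\<psi> $ c:] - (\<Sum>r\<in>UNIV. [:\<eta> r:] * P $ r $ c)"
          by (simp only: poly_eq_0_iff_dvd)
        moreover have "[:-z, 1:] dvd \<delta>" using root by (simp only: poly_eq_0_iff_dvd)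
        ultimately show ?thesis unfolding eq power2_eq_square by (intro mult_dvd_mono)
      qed
      from semisimple_zero_no_left_chain[OF determinantal_divisor_nonzero[OF g] ord this, of r]
      show ?thesis by (simp add: root)
    qed
    then have "\<forall>r. \<exists>p. q $ r = [:-z, 1:] * p" by (meson dvdE poly_eq_0_iff_dvd)
    then obtain p where p: "\<And>r. q $ r = [:-z, 1:] * p r" by metis
    have "(\<Sum>r\<in>UNIV. (\<chi> r. p r) $ r * P $ r $ c) = \<delta>' * [:\<psi> $ c:]" for c
    proof -
      have "[:-z, 1:] * (\<Sum>r\<in>UNIV. (\<chi> r. p r) $ r * P $ r $ c) = [:-z, 1:] * (\<delta>' * [:\<psi> $ c:])"
        using q[of c] by (simp only: p \<delta>' sum_distrib_left mult.assoc vec_lambda_beta)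
      then show ?thesis by (rule mult_left_cancel[THEN iffD1, rotated]) simp
    qed
    moreover have "\<delta>' \<noteq> 0" using \<delta> \<delta>' by (auto simp: good_def)
    ultimately have "good \<delta>'" unfolding good_def by blast
    moreover have "degree \<delta> = Suc (degree \<delta>')"
      using \<open>\<delta>' \<noteq> 0\<close> unfolding \<delta>' by (subst degree_mult_eq) auto
    ultimately show False using least[of \<delta>'] by simp
  qed
  then show ?thesis using q by (rule that)
qed

subsection \<open>Independent transversals\<close>

lemma subspace_set_plus_eq_span:
  fixes S T :: "'a::real_vector set"
  assumes "subspace S" "subspace T"
  shows "S + T = span (S \<union> T)"
  unfolding span_Un assms[THEN span_eq_iff[THEN iffD2]] set_plus_def by auto

text \<open>Sums of sets are Minkowski sums, with \<open>{0}\<close> for the empty family. This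
  turns the sums of subspaces in the solvability criterion into spans of unions, the form that
  Rado's theorem uses.\<close>

lemma sum_subspaces_eq_span:
  fixes U :: "'i \<Rightarrow> 'a::real_vector set"
  assumes "finite P" and "\<And>k. k \<in> P \<Longrightarrow> subspace (U k)"
  shows "(\<Sum>k\<in>P. U k) = span (\<Union>k\<in>P. U k)"
  using assms
proof (induction P rule: finite_induct)
  case (insert k P)
  have "(\<Sum>k\<in>insert k P. U k) = span (U k) + span (\<Union>k\<in>P. U k)"
    using insert by (simp add: span_eq_iff[THEN iffD2])
  also have "\<dots> = span (span (U k) \<union> span (\<Union>k\<in>P. U k))"
    by (rule subspace_set_plus_eq_span) auto
  also have "\<dots> = span (U k \<union> (\<Union>k\<in>P. U k))"
    by (simp only: span_Un span_span)
  finally show ?case by simp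
qed simp

text \<open>Submodularity for arbitrary sets. It is only an inequality, because
  \<open>S \<inter> T\<close> may span less than the intersection of the two spans.\<close>

lemma dim_Un_Int_le:
  fixes S T :: "'a::euclidean_space set"
  shows "dim (S \<union> T) + dim (S \<inter> T) \<le> dim S + dim T"
proof -
  have "dim (S \<union> T) = dim {x + y |x y. x \<in> span S \<and> y \<in> span T}"
    by (simp only: span_Un[symmetric] dim_span)
  moreover have "dim (S \<inter> T) \<le> dim (span S \<inter> span T)"
    by (intro dim_subset Int_mono span_superset)
  ultimately show ?thesis
    using dim_sums_Int[of "span S" "span T"] by simp
qed

text \<open>Rado's theorem: as long as some member of the family has two elements, submodularity of the
  dimension shows that one of the two can be deleted.\<close>

lemma independent_transversal_finite:
  fixes X :: "'i \<Rightarrow> 'a::euclidean_space set"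
  assumes "finite J" and "\<And>k. k \<in> J \<Longrightarrow> finite (X k)"
    and "\<And>P. P \<subseteq> J \<Longrightarrow> card P \<le> dim (\<Union>k\<in>P. X k)"
  shows "\<exists>x. (\<forall>k\<in>J. x k \<in> X k) \<and> inj_on x J \<and> independent (x ` J)"
  using assms
proof (induction "\<Sum>k\<in>J. card (X k)" arbitrary: X rule: less_induct)
  case less
  note finJ = less.prems(1) and finX = less.prems(2) and rado = less.prems(3)
  show ?case
  proof (cases "\<exists>k\<in>J. \<exists>a\<in>X k. \<exists>b\<in>X k. a \<noteq> b")
    case True
    then obtain k a b where k: "k \<in> J" and ab: "a \<in> X k" "b \<in> X k" "a \<noteq> b" by blast
    define rem where "rem c = X(k := X k - {c})" for c
    have step: ?thesis if c: "c \<in> X k" and ok: "\<And>P. P \<subseteq> J \<Longrightarrow> card P \<le> dim (\<Union>l\<in>P. rem c l)" for c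
    proof -
      have "(\<Sum>l\<in>J. card (rem c l)) < (\<Sum>l\<in>J. card (X l))"
      proof (rule sum_strict_mono_ex1[OF finJ])
        show "\<forall>l\<in>J. card (rem c l) \<le> card (X l)"
          using finX by (auto simp: rem_def intro!: card_mono)
        show "\<exists>l\<in>J. card (rem c l) < card (X l)"
          unfolding rem_def using card_Diff1_less[OF finX[OF k] c] k by (intro bexI[of _ k]) simp_all
      qed
      then have "\<exists>x. (\<forall>l\<in>J. x l \<in> rem c l) \<and> inj_on x J \<and> independent (x ` J)"
        by (rule less.hyps[OF _ finJ _ ok]) (use finX in \<open>auto simp: rem_def\<close>)
      moreover have "rem c l \<subseteq> X l" for l by (auto simp: rem_def)
      ultimately show ?thesis by blast
    qed
    \<comment> \<open>A subfamily violating the condition after the deletion must contain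
      \<open>k\<close>. Taking \<open>k\<close> out of it lowers its cardinality by one, which turns
      the strict inequality into \<open>\<le>\<close>.\<close>
    have fails: "\<exists>P0. P0 \<subseteq> J \<and> k \<notin> P0 \<and> dim ((\<Union>l\<in>P0. X l) \<union> (X k - {c})) \<le> card P0"
      if "P \<subseteq> J" "\<not> card P \<le> dim (\<Union>l\<in>P. rem c l)" for P c
    proof -
      have "k \<in> P"
      proof (rule ccontr)
        assume "k \<notin> P"
        then have "(\<Union>l\<in>P. rem c l) = (\<Union>l\<in>P. X l)" by (auto simp: rem_def)
        then show False using that rado by simp
      qed
      then have "(\<Union>l\<in>P. rem c l) = (\<Union>l\<in>P - {k}. X l) \<union> (X k - {c})"
        by (auto simp: rem_def)
      moreover have "card P = Suc (card (P - {k}))"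
        using \<open>k \<in> P\<close> that(1) finJ by (metis card.remove finite_subset)
      ultimately show ?thesis using that by (intro exI[of _ "P - {k}"]) auto
    qed
    show ?thesis
    proof (rule ccontr)
      assume no: "\<not> ?thesis"
      have violated: "\<exists>P0. P0 \<subseteq> J \<and> k \<notin> P0 \<and> dim ((\<Union>l\<in>P0. X l) \<union> (X k - {c})) \<le> card P0"
        if "c \<in> X k" for c
      proof (rule ccontr)
        assume "\<not> ?thesis"
        then have "card P \<le> dim (\<Union>l\<in>P. rem c l)" if "P \<subseteq> J" for P using fails[OF that] by blast
        then show False using step[OF that] no by blast
      qed
      obtain P0 where P0: "P0 \<subseteq> J" "k \<notin> P0" "dim ((\<Union>l\<in>P0. X l) \<union> (X k - {a})) \<le> card P0"
        using violated[OF ab(1)] by (elim exE conjE)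
      obtain Q0 where Q0: "Q0 \<subseteq> J" "k \<notin> Q0" "dim ((\<Union>l\<in>Q0. X l) \<union> (X k - {b})) \<le> card Q0"
        using violated[OF ab(2)] by (elim exE conjE)
      \<comment> \<open>Since \<open>a\<close> and \<open>b\<close> differ,
        \<open>S \<union> T\<close> contains all of \<open>X k\<close>, while
        \<open>S \<inter> T\<close> still contains every \<open>X l\<close> with \<open>l\<close> in
        \<open>P0 \<inter> Q0\<close>. The family condition for both index sets exceeds by one what
        submodularity permits.\<close>
      define S where "S = (\<Union>l\<in>P0. X l) \<union> (X k - {a})"
      define T where "T = (\<Union>l\<in>Q0. X l) \<union> (X k - {b})"
      have fin: "finite P0" "finite Q0" using P0 Q0 finJ finite_subset by auto
      have "S \<union> T = (\<Union>l\<in>insert k (P0 \<union> Q0). X l)"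
        using ab by (auto simp: S_def T_def)
      then have "card (insert k (P0 \<union> Q0)) \<le> dim (S \<union> T)"
        using rado[of "insert k (P0 \<union> Q0)"] k P0 Q0 by simp
      then have "Suc (card (P0 \<union> Q0)) \<le> dim (S \<union> T)"
        using fin P0 Q0 by simp
      moreover have "card (P0 \<inter> Q0) \<le> dim (S \<inter> T)"
        by (rule order_trans[OF rado dim_subset]) (use P0 in \<open>auto simp: S_def T_def\<close>)
      moreover have "dim S \<le> card P0" "dim T \<le> card Q0"
        using P0 Q0 by (auto simp: S_def T_def)
      ultimately show False
        using dim_Un_Int_le[of S T] card_Un_Int[OF fin] by linarith
    qed
  next
    case False
    \<comment> \<open>The condition for \<open>{k}\<close> rules out an empty \<open>X k\<close>, so
      all sets are singletons and the transversal is forced; the condition for \<open>J\<close>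
      itself then gives its injectivity and independence.\<close>
    have "\<exists>x. X k = {x}" if "k \<in> J" for k
    proof -
      have "X k \<noteq> {}" using rado[of "{k}"] that by auto
      then show ?thesis using False that by blast
    qed
    then obtain x where x: "\<And>k. k \<in> J \<Longrightarrow> X k = {x k}" by metis
    then have "(\<Union>k\<in>J. X k) = x ` J" by auto
    then have "card J \<le> dim (x ` J)" using rado[of J] by simp
    moreover have "dim (x ` J) \<le> card (x ` J)"
      using finJ by (intro dim_le_card) (auto simp: span_base)
    moreover have "card (x ` J) \<le> card J" using finJ by (rule card_image_le)
    ultimately have card: "card (x ` J) = card J" "card (x ` J) = dim (x ` J)" by auto
    then have "inj_on x J" "independent (x ` J)"
      using finJ card_eq_dim[of "x ` J" "x ` J"] by (auto simp: span_superset intro: eq_card_imp_inj_on)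
    then show ?thesis using x by (intro exI[of _ x]) auto
  qed
qed

text \<open>Replacing each set by a maximal independent subset makes it finite and keeps the spans,
  hence all dimensions in the hypothesis.\<close>

theorem independent_transversal:
  fixes X :: "'i \<Rightarrow> 'a::euclidean_space set"
  assumes "finite J" and rado: "\<And>P. P \<subseteq> J \<Longrightarrow> card P \<le> dim (\<Union>k\<in>P. X k)"
  obtains x where "\<And>k. k \<in> J \<Longrightarrow> x k \<in> X k" "inj_on x J" "independent (x ` J)"
proof -
  have "\<exists>B. B \<subseteq> X k \<and> independent B \<and> X k \<subseteq> span B" for k
    using maximal_independent_subset[of "X k"] by metis
  then obtain B where B: "\<And>k. B k \<subseteq> X k" "\<And>k. independent (B k)" "\<And>k. X k \<subseteq> span (B k)"
    by metis
  have "card P \<le> dim (\<Union>k\<in>P. B k)" if "P \<subseteq> J" for P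
  proof -
    have "(\<Union>k\<in>P. X k) \<subseteq> span (\<Union>k\<in>P. B k)"
      using B(3) span_mono[of "B _" "\<Union>k\<in>P. B k"] by blast
    then show ?thesis using rado[OF that] dim_mono order_trans by blast
  qed
  then obtain x where x: "\<forall>k\<in>J. x k \<in> B k" "inj_on x J" "independent (x ` J)"
    using independent_transversal_finite[of J B] assms(1) B(2) finiteI_independent by metis
  then show ?thesis using that B(1) by (metis subsetD)
qed

subsection \<open>Spectra on invariant subspaces\<close>

lemma coordinate_functionals:
  fixes E :: "'a::euclidean_space set"
  assumes "independent E"
  obtains \<phi> :: "'a \<Rightarrow> 'a \<Rightarrow> real" where
    "\<And>b. linear (\<phi> b)" "\<And>b e. e \<in> E \<Longrightarrow> \<phi> b e = (if e = b then 1 else 0)"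
    "\<And>x. x \<in> span E \<Longrightarrow> x = (\<Sum>b\<in>E. \<phi> b x *\<^sub>R b)"
proof -
  have "\<exists>f. linear f \<and> (\<forall>e\<in>E. f e = (if e = b then 1 else 0 :: real))" for b
    by (rule linear_independent_extend[OF assms])
  then have "\<exists>\<phi>. \<forall>b. linear (\<phi> b) \<and> (\<forall>e\<in>E. \<phi> b e = (if e = b then 1 else 0 :: real))"
    by (intro choice allI)
  then obtain \<phi> :: "'a \<Rightarrow> 'a \<Rightarrow> real" where \<phi>: "\<And>b. linear (\<phi> b)"
    "\<And>b e. e \<in> E \<Longrightarrow> \<phi> b e = (if e = b then 1 else 0)" by blast
  have fin: "finite E" using assms by (rule finiteI_independent)
  have "x = (\<Sum>b\<in>E. \<phi> b x *\<^sub>R b)" if "x \<in> span E" for x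
  proof -
    have "linear (\<lambda>x. \<Sum>b\<in>E. \<phi> b x *\<^sub>R b)"
      by (intro linear_compose_sum ballI linearI)
        (simp_all add: linear_add[OF \<phi>(1)] linear_scale[OF \<phi>(1)] scaleR_add_left)
    then show ?thesis
      using linear_eq_on_span[OF linear_ident _ _ that, of "\<lambda>x. \<Sum>b\<in>E. \<phi> b x *\<^sub>R b"] fin
      by (simp add: \<phi>(2) if_distrib[of "\<lambda>c. c *\<^sub>R _"] cong: if_cong)
  qed
  with \<phi> show ?thesis by (rule that)
qed

lemma complex_eigenvector_Re_Im:
  fixes M :: "real^'n^'n" and w :: "complex^'n"
  assumes "map_matrix complex_of_real M *v w = z *s w"
  shows "M *v (\<chi> i. Re (w $ i)) = Re z *\<^sub>R (\<chi> i. Re (w $ i)) - Im z *\<^sub>R (\<chi> i. Im (w $ i))"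
    and "M *v (\<chi> i. Im (w $ i)) = Im z *\<^sub>R (\<chi> i. Re (w $ i)) + Re z *\<^sub>R (\<chi> i. Im (w $ i))"
proof -
  have comp: "(\<Sum>j\<in>UNIV. complex_of_real (M $ i $ j) * w $ j) = z * w $ i" for i
    using arg_cong[OF assms, of "\<lambda>v. v $ i"] by (simp add: matrix_vector_mult_def map_matrix_def)
  show "M *v (\<chi> i. Re (w $ i)) = Re z *\<^sub>R (\<chi> i. Re (w $ i)) - Im z *\<^sub>R (\<chi> i. Im (w $ i))"
    using arg_cong[OF comp, of Re] by (simp add: vec_eq_iff matrix_vector_mult_def)
  show "M *v (\<chi> i. Im (w $ i)) = Im z *\<^sub>R (\<chi> i. Re (w $ i)) + Re z *\<^sub>R (\<chi> i. Im (w $ i))"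
    using arg_cong[OF comp, of Im] by (simp add: vec_eq_iff matrix_vector_mult_def algebra_simps)
qed

text \<open>The coordinate functional of \<open>b\<close> turns \<open>M\<close> into multiplication
  by \<open>l b\<close>. Applied to real and imaginary parts it gives the complex
  \<open>b\<close>-coordinate of an eigenvector \<open>w\<close>; some such coordinate is nonzero,
  which identifies the eigenvalue with \<open>l b\<close>.\<close>

lemma spectrum_on_eigenbasis:
  fixes M :: "real^'n^'n"
  assumes E: "independent E" "\<And>b. b \<in> E \<Longrightarrow> M *v b = l b *\<^sub>R b"
  shows "spectrum_on M (span E) \<subseteq> complex_of_real ` l ` E"
proof
  fix z assume "z \<in> spectrum_on M (span E)"
  then obtain w :: "complex^'n" where w: "w \<noteq> 0" "(\<chi> i. Re (w $ i)) \<in> span E" "(\<chi> i. Im (w $ i)) \<in> span E"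
    and eig: "map_matrix complex_of_real M *v w = z *s w"
    unfolding spectrum_on_def by blast
  define x y where "x = (\<chi> i. Re (w $ i))" and "y = (\<chi> i. Im (w $ i))"
  have xy: "x \<in> span E" "y \<in> span E" using w by (simp_all add: x_def y_def)
  note Mx = complex_eigenvector_Re_Im(1)[OF eig, folded x_def y_def]
  note My = complex_eigenvector_Re_Im(2)[OF eig, folded x_def y_def]
  obtain \<phi> where \<phi>: "\<And>b. linear (\<phi> b)" "\<And>b e. e \<in> E \<Longrightarrow> \<phi> b e = (if e = b then 1 else 0 :: real)"
    and coords: "\<And>x. x \<in> span E \<Longrightarrow> x = (\<Sum>b\<in>E. \<phi> b x *\<^sub>R b)"
    using coordinate_functionals[OF E(1)] by blast
  have M_\<phi>: "\<phi> b (M *v u) = l b * \<phi> b u" if "u \<in> span E" "b \<in> E" for u b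
  proof (rule linear_eq_on_span[OF _ _ _ that(1)])
    show "linear (\<lambda>u. \<phi> b (M *v u))"
      using linear_compose[OF matrix_vector_mul_linear \<phi>(1)] by (simp add: o_def)
    show "linear (\<lambda>u. l b * \<phi> b u)"
      using linear_compose_scale_right[OF \<phi>(1)] by simp
    show "\<phi> b (M *v e) = l b * \<phi> b e" if "e \<in> E" for e
      using that by (simp add: E(2) linear_scale[OF \<phi>(1)] \<phi>(2))
  qed
  have "\<exists>b\<in>E. \<phi> b x \<noteq> 0 \<or> \<phi> b y \<noteq> 0"
  proof (rule ccontr)
    assume "\<not> ?thesis"
    then have "x = 0" "y = 0" using coords[OF xy(1)] coords[OF xy(2)] by (auto intro: sum.neutral)
    then have "w = 0" by (simp add: x_def y_def vec_eq_iff complex_eq_iff)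
    then show False using w by simp
  qed
  then obtain b where b: "b \<in> E" "\<phi> b x \<noteq> 0 \<or> \<phi> b y \<noteq> 0" by blast
  have "l b * \<phi> b x = Re z * \<phi> b x - Im z * \<phi> b y" "l b * \<phi> b y = Im z * \<phi> b x + Re z * \<phi> b y"
    using M_\<phi>[OF xy(1) b(1)] M_\<phi>[OF xy(2) b(1)] unfolding Mx My
    by (simp_all add: linear_diff[OF \<phi>(1)] linear_add[OF \<phi>(1)] linear_scale[OF \<phi>(1)])
  then have "(complex_of_real (l b) - z) * Complex (\<phi> b x) (\<phi> b y) = 0"
    by (simp add: complex_eq_iff algebra_simps)
  moreover have "Complex (\<phi> b x) (\<phi> b y) \<noteq> 0" using b by (simp add: complex_eq_iff)
  ultimately show "z \<in> complex_of_real ` l ` E" using b(1) by auto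
qed

lemma eigenvalue_in_spectrum_on:
  fixes M :: "real^'n^'n"
  assumes "M *v v = l *\<^sub>R v" "v \<noteq> 0" "v \<in> V" "0 \<in> V"
  shows "complex_of_real l \<in> spectrum_on M V"
proof -
  define w :: "complex^'n" where "w = (\<chi> i. complex_of_real (v $ i))"
  have "w \<noteq> 0" using assms(2) by (auto simp: w_def vec_eq_iff)
  moreover have "map_matrix complex_of_real M *v w = complex_of_real l *s w"
    using assms(1) by (simp add: vec_eq_iff matrix_vector_mult_def w_def flip: of_real_mult of_real_sum)
  moreover have "(\<chi> i. Re (w $ i)) = v" "(\<chi> i. Im (w $ i)) = 0" by (simp_all add: w_def vec_eq_iff)
  ultimately show ?thesis using assms unfolding spectrum_on_def by auto
qed

text \<open>Evaluation at a root \<open>a\<close> of \<open>\<delta>\<close> gives \<open>h((T - a) y)(a) = 0\<close>, so surjectivity of \<open>T - a\<close> lets us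
  cancel \<open>s - a\<close> in the equation; when \<open>\<delta>\<close> is constant, comparing degrees gives \<open>h = 0\<close>.\<close>

lemma shift_equation_trivial:
  fixes S :: "(complex^'n) set" and h :: "complex^'n \<Rightarrow> complex poly"
  assumes "\<delta> \<noteq> 0" "\<And>x. x \<in> S \<Longrightarrow> T x \<in> S"
    and "\<And>a x. poly \<delta> a = 0 \<Longrightarrow> x \<in> S \<Longrightarrow> \<exists>y\<in>S. x = T y - a *s y"
    and "\<And>c x y. x \<in> S \<Longrightarrow> y \<in> S \<Longrightarrow> h (x - c *s y) = h x - smult c (h y)"
    and "\<And>x. x \<in> S \<Longrightarrow> degree (h x) \<le> N"
    and "\<And>x. x \<in> S \<Longrightarrow> \<delta> * [:\<psi> x:] = h (T x) - [:0, 1:] * h x"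
    and "x \<in> S"
  shows "\<psi> x = 0"
  using assms
proof (induction "degree \<delta>" arbitrary: \<delta> h rule: less_induct)
  case less
  note nz = less.prems(1) and T = less.prems(2) and surj = less.prems(3) and lin = less.prems(4)
    and deg = less.prems(5) and eq = less.prems(6)
  show ?case
  proof (cases "degree \<delta> = 0")
    case True
    then obtain c where c: "\<delta> = [:c:]" "c \<noteq> 0" using nz by (metis degree_eq_zeroE pCons_0_0)
    \<comment> \<open>The uniform bound \<open>N\<close> permits a choice of \<open>u\<close> with
      \<open>h u\<close> of greatest degree. Multiplying \<open>h u\<close> by \<open>s\<close>
      raises that degree, whereas the equation equates the product with \<open>h (T u)\<close> up to
      a constant.\<close>
    have h0: "h y = 0" if "y \<in> S" for y
    proof (rule ccontr)
      assume "h y \<noteq> 0"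
      have "\<exists>u. (u \<in> S \<and> h u \<noteq> 0) \<and> (\<forall>v. v \<in> S \<and> h v \<noteq> 0 \<longrightarrow> degree (h v) \<le> degree (h u))"
        by (rule ex_has_greatest_nat[of _ y _ "Suc N"]) (use that \<open>h y \<noteq> 0\<close> deg in \<open>auto simp: less_Suc_eq_le\<close>)
      then obtain u where u: "u \<in> S" "h u \<noteq> 0"
        and max: "\<And>v. v \<in> S \<Longrightarrow> h v \<noteq> 0 \<Longrightarrow> degree (h v) \<le> degree (h u)" by blast
      have "[:0, 1:] * h u = h (T u) - [:c * \<psi> u:]"
        using eq[OF u(1)] c by (simp add: algebra_simps)
      moreover have "degree (h (T u)) \<le> degree (h u)"
        using max[OF T[OF u(1)]] by (cases "h (T u) = 0") auto
      ultimately have "degree ([:0, 1:] * h u) \<le> degree (h u)"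
        by (simp add: degree_diff_le)
      moreover have "degree ([:0, 1:] * h u) = Suc (degree (h u))"
        using u(2) by (subst degree_mult_eq) auto
      ultimately show False by simp
    qed
    then show ?thesis using eq[OF less.prems(7)] h0[OF less.prems(7)] h0[OF T[OF less.prems(7)]] c by simp
  next
    case False
    then have "\<not> constant (poly \<delta>)" by (simp add: constant_degree)
    then obtain a where a: "poly \<delta> a = 0" using fundamental_theorem_of_algebra by blast
    then obtain \<delta>' where \<delta>': "\<delta> = [:-a, 1:] * \<delta>'" unfolding poly_eq_0_iff_dvd by blast
    have "[:-a, 1:] dvd h x" if "x \<in> S" for x
    proof -
      obtain y where y: "y \<in> S" "x = T y - a *s y" using surj[OF a \<open>x \<in> S\<close>] by blast
      have "poly (\<delta> * [:\<psi> y:]) a = 0" using a by simp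
      then have "poly (h x) a = 0"
        unfolding eq[OF y(1)] y(2) lin[OF T[OF y(1)] y(1)] by simp
      then show ?thesis by (simp only: poly_eq_0_iff_dvd)
    qed
    then have h_div: "h x = [:-a, 1:] * (h x div [:-a, 1:])" if "x \<in> S" for x
      using that by (simp only: dvd_mult_div_cancel)
    have cancel: "p = q" if "[:-a, 1:] * p = [:-a, 1:] * q" for p q :: "complex poly"
      using that by (rule mult_left_cancel[THEN iffD1, rotated]) simp
    show ?thesis
    proof (rule less.hyps[of \<delta>' "\<lambda>x. h x div [:-a, 1:]"])
      show "\<delta>' \<noteq> 0" using nz \<delta>' by auto
      then show "degree \<delta>' < degree \<delta>" unfolding \<delta>' by (subst degree_mult_eq) auto
      show "\<exists>y\<in>S. x = T y - c *s y" if "poly \<delta>' c = 0" "x \<in> S" for c x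
        using surj[of c x] that by (simp add: \<delta>')
      show "(h (x - c *s y)) div [:-a, 1:] = h x div [:-a, 1:] - smult c (h y div [:-a, 1:])"
        if "x \<in> S" "y \<in> S" for c x y
        using lin[OF that, of c] by (simp add: poly_div_diff_left div_smult_left)
      show "degree (h x div [:-a, 1:]) \<le> N" if "x \<in> S" for x
      proof (cases "h x div [:-a, 1:] = 0")
        case False
        then have "degree (h x) = Suc (degree (h x div [:-a, 1:]))"
          by (subst h_div[OF that], subst degree_mult_eq) auto
        then show ?thesis using deg[OF that] by simp
      qed simp
      show "\<delta>' * [:\<psi> x:] = h (T x) div [:-a, 1:] - [:0, 1:] * (h x div [:-a, 1:])" if "x \<in> S" for x
      proof (rule cancel)
        have "[:-a, 1:] * (\<delta>' * [:\<psi> x:]) = h (T x) - [:0, 1:] * h x"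
          using eq[OF that] by (simp only: \<delta>' mult.assoc)
        also have "\<dots> = [:-a, 1:] * (h (T x) div [:-a, 1:]) - [:0, 1:] * ([:-a, 1:] * (h x div [:-a, 1:]))"
          using h_div[OF that] h_div[OF T[OF that]] by (simp only:)
        also have "\<dots> = [:-a, 1:] * (h (T x) div [:-a, 1:] - [:0, 1:] * (h x div [:-a, 1:]))"
          by (simp only: right_diff_distrib mult.left_commute)
        finally show "[:-a, 1:] * (\<delta>' * [:\<psi> x:]) = \<dots>" .
      qed
    qed (use T less.prems(7) in auto)
  qed
qed

text \<open>\<open>S\<close> is the complexification of \<open>V\<close>, treated as a
  finite-dimensional real space. As \<open>a\<close> is not in the spectrum on \<open>V\<close>, the
  map is injective on \<open>S\<close>; it maps \<open>S\<close> into itself, so it is also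
  onto.\<close>

lemma complexification_surj:
  fixes M :: "real^'n^'n"
  assumes V: "subspace V" and inv: "\<And>v. v \<in> V \<Longrightarrow> M *v v \<in> V"
    and a: "a \<notin> spectrum_on M V"
  defines "S \<equiv> {w :: complex^'n. (\<chi> i. Re (w $ i)) \<in> V \<and> (\<chi> i. Im (w $ i)) \<in> V}"
  assumes x: "x \<in> S"
  shows "\<exists>y\<in>S. x = map_matrix complex_of_real M *v y - a *s y"
proof -
  define T where "T = (\<lambda>y :: complex^'n. map_matrix complex_of_real M *v y - a *s y)"
  have Re_T: "(\<chi> i. Re (T y $ i)) = M *v (\<chi> i. Re (y $ i)) - Re a *\<^sub>R (\<chi> i. Re (y $ i)) + Im a *\<^sub>R (\<chi> i. Im (y $ i))"
    and Im_T: "(\<chi> i. Im (T y $ i)) = M *v (\<chi> i. Im (y $ i)) - Im a *\<^sub>R (\<chi> i. Re (y $ i)) - Re a *\<^sub>R (\<chi> i. Im (y $ i))" for y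
    by (simp_all add: T_def vec_eq_iff matrix_vector_mult_def)
  have "linear T"
    by (intro linearI) (simp_all add: T_def vec_eq_iff matrix_vector_mult_def algebra_simps
        sum.distrib scaleR_sum_right)
  have S: "subspace S"
    unfolding subspace_def S_def
  proof (intro conjI ballI allI)
    show "0 \<in> {w :: complex^'n. (\<chi> i. Re (w $ i)) \<in> V \<and> (\<chi> i. Im (w $ i)) \<in> V}"
      using subspace_0[OF V] by (simp add: zero_vec_def)
  next
    fix x y :: "complex^'n"
    assume "x \<in> {w. (\<chi> i. Re (w $ i)) \<in> V \<and> (\<chi> i. Im (w $ i)) \<in> V}"
      "y \<in> {w. (\<chi> i. Re (w $ i)) \<in> V \<and> (\<chi> i. Im (w $ i)) \<in> V}"
    then have "(\<chi> i. Re (x $ i)) + (\<chi> i. Re (y $ i)) \<in> V" "(\<chi> i. Im (x $ i)) + (\<chi> i. Im (y $ i)) \<in> V"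
      using subspace_add[OF V] by auto
    then show "x + y \<in> {w. (\<chi> i. Re (w $ i)) \<in> V \<and> (\<chi> i. Im (w $ i)) \<in> V}"
      by (simp add: plus_vec_def)
  next
    fix c and x :: "complex^'n"
    assume "x \<in> {w. (\<chi> i. Re (w $ i)) \<in> V \<and> (\<chi> i. Im (w $ i)) \<in> V}"
    then have "c *\<^sub>R (\<chi> i. Re (x $ i)) \<in> V" "c *\<^sub>R (\<chi> i. Im (x $ i)) \<in> V"
      using subspace_scale[OF V] by auto
    then show "c *\<^sub>R x \<in> {w. (\<chi> i. Re (w $ i)) \<in> V \<and> (\<chi> i. Im (w $ i)) \<in> V}"
      by (simp add: scaleR_vec_def)
  qed
  have T_S: "T ` S \<subseteq> S"
  proof (rule image_subsetI)
    fix y assume "y \<in> S"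
    then have "(\<chi> i. Re (y $ i)) \<in> V" "(\<chi> i. Im (y $ i)) \<in> V" by (auto simp: S_def)
    then have "(\<chi> i. Re (T y $ i)) \<in> V" "(\<chi> i. Im (T y $ i)) \<in> V"
      unfolding Re_T Im_T
      by (auto intro!: subspace_add[OF V] subspace_diff[OF V] subspace_scale[OF V] inv)
    then show "T y \<in> S" by (simp add: S_def)
  qed
  have "inj_on T S"
  proof (subst linear_inj_on_iff_eq_0[OF \<open>linear T\<close> S], intro ballI impI)
    fix y assume "y \<in> S" "T y = 0"
    then show "y = 0" using a by (auto simp: spectrum_on_def S_def T_def)
  qed
  then have "dim (T ` S) = dim S"
    using dim_image_eq[OF \<open>linear T\<close>, of S] S by (simp add: span_eq_iff[THEN iffD2])
  then have "T ` S = S"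
    using subspace_dim_equal[OF linear_subspace_image[OF \<open>linear T\<close> S] S T_S] by simp
  then show ?thesis using x by (auto simp: T_def)
qed

text \<open>The linear polynomials in the hypothesis are the entries of \<open>(M - s) v\<close>, so
  it reads \<open>q(s) (M - s) v = \<delta>(s) (\<psi> \<bullet> v)\<close>. It is given for real
  \<open>v\<close> only. Complex-linear extension to the complexification of \<open>V\<close> is
  needed because the roots of \<open>\<delta>\<close> may be nonreal; there
  \<open>shift_equation_trivial\<close> applies with \<open>h w = q w\<close>.\<close>

lemma functional_vanishes_on_invariant_subspace:
  fixes M :: "real^'n^'n" and q :: "complex poly^'n"
  assumes V: "subspace V" "\<And>v. v \<in> V \<Longrightarrow> M *v v \<in> V"
    and \<delta>: "\<delta> \<noteq> 0" "\<And>z. z \<in> spectrum_on M V \<Longrightarrow> poly \<delta> z \<noteq> 0"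
    and eq: "\<And>v. v \<in> V \<Longrightarrow>
      (\<Sum>i\<in>UNIV. q $ i * [:complex_of_real ((M *v v) $ i), - complex_of_real (v $ i):])
        = \<delta> * [:complex_of_real (\<psi> \<bullet> v):]"
    and v: "v \<in> V"
  shows "\<psi> \<bullet> v = 0"
proof -
  define S where "S = {w :: complex^'n. (\<chi> i. Re (w $ i)) \<in> V \<and> (\<chi> i. Im (w $ i)) \<in> V}"
  define h where "h w = (\<Sum>i\<in>UNIV. q $ i * [:w $ i:])" for w :: "complex^'n"
  define T where "T = (*v) (map_matrix complex_of_real M)"
  define emb where "emb v = (\<chi> i. complex_of_real (v $ i))" for v :: "real^'n"
  define f where "f w = (\<Sum>i\<in>UNIV. complex_of_real (\<psi> $ i) * w $ i)" for w :: "complex^'n"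
  have h_lin: "h (x + c *s y) = h x + smult c (h y)" for x y c
  proof -
    have "h (x + c *s y) = h x + [:c:] * h y"
      unfolding h_def sum_distrib_left sum.distrib[symmetric]
      by (rule sum.cong) (simp_all add: smult_add_left mult.commute)
    then show ?thesis by simp
  qed
  have f_lin: "f (x + c *s y) = f x + c * f y" for x y c
    by (simp add: f_def sum.distrib sum_distrib_left algebra_simps)
  have T_lin: "T (x + c *s y) = T x + c *s T y" for x y c
    by (simp add: T_def matrix_vector_right_distrib vector_scalar_commute)
  have T_emb: "T (emb v) = emb (M *v v)" for v
    by (simp add: T_def emb_def vec_eq_iff matrix_vector_mult_def)
  have f_emb: "f (emb v) = complex_of_real (\<psi> \<bullet> v)" for v
    by (simp add: f_def emb_def inner_vec_def)
  have eq_emb: "\<delta> * [:f (emb u):] = h (T (emb u)) - [:0, 1:] * h (emb u)" if "u \<in> V" for u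
  proof -
    have "h (T (emb u)) - [:0, 1:] * h (emb u)
      = (\<Sum>i\<in>UNIV. q $ i * ([:complex_of_real ((M *v u) $ i):] - [:0, 1:] * [:complex_of_real (u $ i):]))"
      unfolding T_emb h_def sum_distrib_left sum_subtractf[symmetric]
      by (intro sum.cong refl) (simp only: emb_def vec_lambda_beta right_diff_distrib mult.left_commute)
    then show ?thesis using eq[OF that] by (simp add: f_emb)
  qed
  have "f (emb v) = 0"
  proof (rule shift_equation_trivial[of \<delta> S T h "Max (range (\<lambda>i. degree (q $ i)))" f])
    show "\<delta> \<noteq> 0" by (rule \<delta>(1))
    show "\<exists>y\<in>S. x = T y - a *s y" if "poly \<delta> a = 0" "x \<in> S" for a x
      unfolding T_def S_def
      by (rule complexification_surj[OF V]) (use \<delta>(2) that in \<open>auto simp: S_def\<close>)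
    show "h (x - c *s y) = h x - smult c (h y)" for c x y
      using h_lin[of x "-c" y] by simp
    show "degree (h x) \<le> Max (range (\<lambda>i. degree (q $ i)))" for x
      unfolding h_def
    proof (rule degree_sum_le)
      fix i
      have "degree (q $ i * [:x $ i:]) \<le> degree (q $ i)" by (simp add: degree_smult_le)
      also have "\<dots> \<le> Max (range (\<lambda>i. degree (q $ i)))" by (rule Max_ge) auto
      finally show "degree (q $ i * [:x $ i:]) \<le> Max (range (\<lambda>i. degree (q $ i)))" .
    qed simp
    show "emb v \<in> S" using v V(1) by (simp add: S_def emb_def subspace_0 zero_vec_def[symmetric])
    fix x assume "x \<in> S"
    define a b where "a = (\<chi> i. Re (x $ i))" and "b = (\<chi> i. Im (x $ i))"
    have ab: "a \<in> V" "b \<in> V" using \<open>x \<in> S\<close> by (auto simp: S_def a_def b_def)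
    have x: "x = emb a + \<i> *s emb b"
      by (simp add: vec_eq_iff emb_def a_def b_def complex_eq)
    have Tx: "T x = emb (M *v a) + \<i> *s emb (M *v b)" unfolding x T_lin T_emb ..
    show "T x \<in> S"
      unfolding Tx S_def using V(2)[OF ab(1)] V(2)[OF ab(2)] by (simp add: emb_def)
    have "\<delta> * [:f x:] = \<delta> * [:f (emb a):] + smult \<i> (\<delta> * [:f (emb b):])"
      unfolding x f_lin by (simp add: smult_add_left mult.commute)
    also have "\<dots> = (h (T (emb a)) + smult \<i> (h (T (emb b)))) - [:0, 1:] * (h (emb a) + smult \<i> (h (emb b)))"
      unfolding eq_emb[OF ab(1)] eq_emb[OF ab(2)] by (simp add: algebra_simps smult_diff_right)
    also have "\<dots> = h (T x) - [:0, 1:] * h x"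
      unfolding x T_lin h_lin ..
    finally show "\<delta> * [:f x:] = h (T x) - [:0, 1:] * h x" .
  qed
  then show ?thesis by (simp add: f_emb)
qed

subsection \<open>The largest stabilizability output-nulling subspace\<close>

lemma sum_UNIV_Plus:
  fixes f :: "'a::finite + 'b::finite \<Rightarrow> 'c::comm_monoid_add"
  shows "sum f UNIV = (\<Sum>a\<in>UNIV. f (Inl a)) + (\<Sum>b\<in>UNIV. f (Inr b))"
  by (simp add: UNIV_Plus_UNIV[symmetric] sum.Plus del: UNIV_Plus_UNIV)

definition stack :: "'a^'n \<Rightarrow> 'a^'m \<Rightarrow> 'a^('n + 'm)" where
  "stack v w = (\<chi> c. case c of Inl j \<Rightarrow> v $ j | Inr k \<Rightarrow> w $ k)"

lemma stack_nth [simp]: "stack v w $ Inl j = v $ j" "stack v w $ Inr k = w $ k"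
  by (simp_all add: stack_def)

lemma stack_eq_iff: "x = stack v w \<longleftrightarrow> (\<forall>j. x $ Inl j = v $ j) \<and> (\<forall>k. x $ Inr k = w $ k)"
  by (auto simp: vec_eq_iff stack_def split: sum.split)

text \<open>The value of the system pencil at a real point, kept as a real matrix so that real inner
  products and orthogonal complements are available.\<close>

definition real_pencil ::
  "real^'n^'n \<Rightarrow> real^'m^'n \<Rightarrow> real^'n^'p \<Rightarrow> real^'m^'p \<Rightarrow> real \<Rightarrow> real^('n + 'm)^('n + 'p)" where
  "real_pencil A B C D l =
     (\<chi> r. case r of Inl i \<Rightarrow> stack ((A - l *\<^sub>R mat 1) $ i) (B $ i) | Inr h \<Rightarrow> stack (C $ h) (D $ h))"

lemma real_pencil_mult:
  "real_pencil A B C D l *v stack v w =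
     stack ((A - l *\<^sub>R mat 1) *v v + B *v w) (C *v v + D *v w)"
  unfolding stack_eq_iff
  by (simp add: real_pencil_def matrix_vector_mult_def sum_UNIV_Plus)

lemma system_pencil_of_real:
  "poly (system_pencil A B C D $ r $ c) (complex_of_real l) = complex_of_real (real_pencil A B C D l $ r $ c)"
  by (auto simp: system_pencil_def real_pencil_def stack_def mat_def split: sum.split)

definition output_zeroing ::
  "real^'n^'n \<Rightarrow> real^'m^'n \<Rightarrow> real^'n^'p \<Rightarrow> real^'m^'p \<Rightarrow> real \<Rightarrow> (real^'n) set" where
  "output_zeroing A B C D l =
     {v. \<exists>w. (A - l *\<^sub>R mat 1) *v v + B *v w = 0 \<and> C *v v + D *v w = 0}"

text \<open>The row space of a real matrix is the orthogonal complement of its kernel. Each kernel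
  vector \<open>stack v w\<close> has \<open>v\<close> in \<open>output_zeroing\<close>, so
  \<open>stack \<psi> 0\<close> is orthogonal to the kernel. Concretely, its component
  \<open>z\<close> orthogonal to the row space lies in the kernel and is therefore orthogonal to
  itself.\<close>

lemma pencil_row_combination:
  assumes \<psi>: "\<And>v. v \<in> output_zeroing A B C D l \<Longrightarrow> \<psi> \<bullet> v = 0"
  shows "\<exists>\<eta>. \<forall>c. (\<Sum>r\<in>UNIV. \<eta> r * poly (system_pencil A B C D $ r $ c) (complex_of_real l))
    = stack (\<chi> i. complex_of_real (\<psi> $ i)) 0 $ c"
proof -
  define R where "R = real_pencil A B C D l"
  define S where "S = range (\<lambda>\<eta>. \<eta> v* R)"
  have "linear (\<lambda>\<eta>. \<eta> v* R)" by (simp add: flip: transpose_matrix_vector)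
  then have S: "subspace S" unfolding S_def by (intro linear_subspace_image) auto
  obtain y z where y: "y \<in> span S" and z: "\<And>w. w \<in> span S \<Longrightarrow> orthogonal z w"
    and yz: "stack \<psi> 0 = y + z"
    using orthogonal_subspace_decomp_exists[of S "stack \<psi> 0"] by metis
  have "\<eta> \<bullet> (R *v z) = 0" for \<eta>
  proof -
    have "z \<bullet> (\<eta> v* R) = 0"
      using z[of "\<eta> v* R"] by (simp add: S_def span_base orthogonal_def)
    then show ?thesis by (simp add: inner_commute[of z] dot_lmul_matrix)
  qed
  then have Rz: "R *v z = 0" by (metis inner_eq_zero_iff)
  define v w where "v = (\<chi> j. z $ Inl j)" and "w = (\<chi> k. z $ Inr k)"
  have z_eq: "z = stack v w" by (simp add: stack_eq_iff v_def w_def)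
  have "stack ((A - l *\<^sub>R mat 1) *v v + B *v w) (C *v v + D *v w) = 0"
    using Rz unfolding R_def z_eq real_pencil_mult .
  then have "0 = stack ((A - l *\<^sub>R mat 1) *v v + B *v w) (C *v v + D *v w)" by simp
  then have "v \<in> output_zeroing A B C D l"
    unfolding stack_eq_iff output_zeroing_def by (intro CollectI exI[of _ w]) (simp add: vec_eq_iff)
  then have "\<psi> \<bullet> v = 0" by (rule \<psi>)
  then have "stack \<psi> 0 \<bullet> z = 0" by (simp add: z_eq inner_vec_def sum_UNIV_Plus)
  moreover have "y \<bullet> z = 0" using z[OF y] by (simp add: orthogonal_def inner_commute)
  ultimately have "z \<bullet> z = 0" unfolding yz by (simp add: inner_add_left)
  then have "stack \<psi> 0 \<in> S" using y yz S by (simp add: span_eq_iff[THEN iffD2])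
  then obtain \<eta> where \<eta>: "stack \<psi> 0 = \<eta> v* R" by (auto simp: S_def)
  show ?thesis
  proof (intro exI allI)
    fix c
    have "(\<Sum>r\<in>UNIV. complex_of_real (\<eta> $ r) * poly (system_pencil A B C D $ r $ c) (complex_of_real l))
      = complex_of_real ((\<eta> v* R) $ c)"
      by (simp add: system_pencil_of_real vector_matrix_mult_def R_def mult.commute)
    also have "\<dots> = stack (\<chi> i. complex_of_real (\<psi> $ i)) 0 $ c"
      by (simp add: stack_def flip: \<eta> split: sum.split)
    finally show "(\<Sum>r\<in>UNIV. complex_of_real (\<eta> $ r) * poly (system_pencil A B C D $ r $ c) (complex_of_real l))
      = stack (\<chi> i. complex_of_real (\<psi> $ i)) 0 $ c" .
  qed
qed

section \<open>Full row rank of the pencil away from the invariant zeros\<close>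

lemma rank_le_rows: "rank N \<le> CARD('r)" for N :: "'a::field^'c^'r"
proof -
  have rows: "rows N = range (\<lambda>i. row i N)" by (auto simp: rows_def)
  have "vec.dim (rows N) \<le> card (rows N)"
    by (rule vec.dim_le_card) (auto simp: rows vec.span_base)
  also have "\<dots> \<le> CARD('r)" unfolding rows by (rule card_image_le) simp
  finally show ?thesis by (simp add: row_rank_def_gen)
qed

lemma right_invertible_full_rank:
  fixes A :: "real^'n^'n" and B :: "real^'m^'n" and C :: "real^'n^'p" and D :: "real^'m^'p"
  assumes "right_invertible A B C D"
  obtains z where "rank (eval_matrix (system_pencil A B C D) z) = CARD('n + 'p)"
proof -
  have "infinite (UNIV :: complex set)" by (rule infinite_UNIV_char_0)
  then obtain z where "z \<notin> {z. rank (eval_matrix (system_pencil A B C D) z) \<noteq> CARD('n) + CARD('p)}"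
    using assms unfolding right_invertible_def by (metis ex_new_if_finite)
  then show ?thesis using that[of z] by (simp add: card_UNIV_sum)
qed

lemma right_invertible_normal_rank:
  fixes A :: "real^'n^'n" and B :: "real^'m^'n" and C :: "real^'n^'p" and D :: "real^'m^'p"
  assumes "right_invertible A B C D"
  shows "normal_rank (system_pencil A B C D) = CARD('n + 'p)"
  unfolding normal_rank_def
proof (rule Max_eqI)
  show "finite (range (\<lambda>z. rank (eval_matrix (system_pencil A B C D) z)))"
    by (rule finite_subset[of _ "{..CARD('n + 'p)}"]) (use rank_le_rows in blast)+
  show "CARD('n + 'p) \<in> range (\<lambda>z. rank (eval_matrix (system_pencil A B C D) z))"
    using right_invertible_full_rank[OF assms] by (metis rangeI)
qed (use rank_le_rows in blast)

lemma not_invariant_zero_full_rank: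
  fixes A :: "real^'n^'n" and B :: "real^'m^'n" and C :: "real^'n^'p" and D :: "real^'m^'p"
  assumes "right_invertible A B C D" and "z \<notin> invariant_zeros A B C D"
  shows "rank (eval_matrix (system_pencil A B C D) z) = CARD('n + 'p)"
  using assms(2) rank_le_rows[of "eval_matrix (system_pencil A B C D) z"]
  by (simp add: invariant_zeros_def right_invertible_normal_rank[OF assms(1)] del: card_UNIV_sum)

text \<open>A real relation among the real rows is also a complex one, so full complex row rank
  yields a real right inverse. Applied to \<open>(0, e)\<close> it provides a state and an input
  that realize the output direction \<open>e\<close>.\<close>

lemma pencil_surj:
  assumes ri: "right_invertible A B C D" and l: "complex_of_real l \<notin> invariant_zeros A B C D"
  obtains v w where "(A - l *\<^sub>R mat 1) *v v + B *v w = 0" "C *v v + D *v w = e"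
proof -
  define R where "R = real_pencil A B C D l"
  have "\<forall>c. (\<Sum>i\<in>UNIV. c i *s row i R) = 0 \<longrightarrow> (\<forall>i. c i = 0)"
  proof (intro allI impI)
    fix c i assume c: "(\<Sum>i\<in>UNIV. c i *s row i R) = 0"
    have "(\<Sum>i\<in>UNIV. complex_of_real (c i) * eval_matrix (system_pencil A B C D) (complex_of_real l) $ i $ j) = 0" for j
    proof -
      have "(\<Sum>i\<in>UNIV. c i * R $ i $ j) = 0"
        using arg_cong[OF c, of "\<lambda>v. v $ j"] by (simp add: row_def)
      then have "complex_of_real (\<Sum>i\<in>UNIV. c i * R $ i $ j) = 0" by simp
      then show ?thesis by (simp add: eval_matrix_def system_pencil_of_real R_def)
    qed
    from left_kernel_trivial[OF not_invariant_zero_full_rank[OF ri l] this, of i]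
    show "c i = 0" by simp
  qed
  then obtain X where X: "R ** X = mat 1"
    unfolding matrix_right_invertible_independent_rows[symmetric] by (elim exE)
  define x where "x = X *v stack 0 e"
  define v w where "v = (\<chi> j. x $ Inl j)" and "w = (\<chi> k. x $ Inr k)"
  have x_eq: "x = stack v w" by (simp add: stack_eq_iff v_def w_def)
  have "stack 0 e = R *v x" by (simp add: x_def matrix_vector_mul_assoc X)
  then have "stack 0 e = stack ((A - l *\<^sub>R mat 1) *v v + B *v w) (C *v v + D *v w)"
    by (simp only: R_def x_eq real_pencil_mult)
  then show ?thesis unfolding stack_eq_iff by (intro that[of v w]) (simp_all add: vec_eq_iff)
qed

section \<open>Feedback matrices with prescribed closed-loop eigenvectors\<close>

lemma feedback_exists:
  fixes E :: "(real^'n) set" and w :: "real^'n \<Rightarrow> real^'m"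
  assumes "independent E"
  obtains F :: "real^'n^'m" where "\<And>b. b \<in> E \<Longrightarrow> F *v b = w b"
proof -
  obtain f where f: "linear f" "\<forall>b\<in>E. f b = w b"
    using linear_independent_extend[OF assms] by metis
  then show ?thesis using that[of "matrix f"] by (simp add: matrix_works)
qed

lemma closed_loop_mult:
  fixes F :: "real^'n^'m"
  shows "(A + B ** F) *v v = A *v v + B *v (F *v v)" "(C + D ** F) *v v = C *v v + D *v (F *v v)"
  by (simp_all add: matrix_vector_mult_add_rdistrib matrix_vector_mul_assoc)

lemma eigenvector_pencil_iff:
  fixes A :: "real^'n^'n"
  shows "A *v v + x = l *\<^sub>R v \<longleftrightarrow> (A - l *\<^sub>R mat 1) *v v + x = 0"
  by (simp add: matrix_vector_mult_diff_rdistrib scaleR_matrix_vector_assoc[symmetric] algebra_simps)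

text \<open>The plain union is kept instead of its span: each member belongs to a single stable
  \<open>l\<close> and can be made a closed-loop eigenvector, which a general element of the span
  cannot.\<close>

definition stable_output_zeroing ::
  "time_domain \<Rightarrow> real^'n^'n \<Rightarrow> real^'m^'n \<Rightarrow> real^'n^'p \<Rightarrow> real^'m^'p \<Rightarrow> (real^'n) set" where
  "stable_output_zeroing \<tau> A B C D =
     (\<Union>l\<in>{l. complex_of_real l \<in> stability_region \<tau>}. output_zeroing A B C D l)"

text \<open>A basis of the span is taken inside the union. The feedback that sends each basis vector
  to its own input makes all of them eigenvectors with stable real eigenvalues and zero
  output.\<close>

lemma span_stable_output_zeroing:
  "stabilizability_output_nulling \<tau> A B C D (span (stable_output_zeroing \<tau> A B C D))"
proof -
  obtain E where E: "E \<subseteq> stable_output_zeroing \<tau> A B C D" "independent E"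
    "stable_output_zeroing \<tau> A B C D \<subseteq> span E"
    using maximal_independent_subset[of "stable_output_zeroing \<tau> A B C D"] by metis
  then have span_E: "span (stable_output_zeroing \<tau> A B C D) = span E"
    by (metis span_mono span_span subset_antisym)
  have "\<exists>l w. complex_of_real l \<in> stability_region \<tau> \<and>
      (A - l *\<^sub>R mat 1) *v b + B *v w = 0 \<and> C *v b + D *v w = 0" if "b \<in> E" for b
  proof -
    have "b \<in> stable_output_zeroing \<tau> A B C D" using E(1) that by blast
    then show ?thesis by (auto simp: stable_output_zeroing_def output_zeroing_def)
  qed
  then obtain l w where lw: "\<And>b. b \<in> E \<Longrightarrow> complex_of_real (l b) \<in> stability_region \<tau> \<and>
      (A - l b *\<^sub>R mat 1) *v b + B *v w b = 0 \<and> C *v b + D *v w b = 0" by metis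
  obtain F where F: "\<And>b. b \<in> E \<Longrightarrow> F *v b = w b" using feedback_exists[OF E(2)] by blast
  have eig: "(A + B ** F) *v b = l b *\<^sub>R b" and null: "(C + D ** F) *v b = 0" if "b \<in> E" for b
    using lw[OF that] by (simp_all add: closed_loop_mult eigenvector_pencil_iff F[OF that])
  have "(A + B ** F) *v v \<in> span E" if "v \<in> span E" for v
  proof -
    have "(A + B ** F) *v v \<in> (*v) (A + B ** F) ` span E" using that by blast
    also have "\<dots> = span ((*v) (A + B ** F) ` E)"
      by (rule linear_span_image[symmetric]) simp
    also have "\<dots> \<subseteq> span E"
      by (rule span_minimal) (auto simp: eig span_base span_scale)
    finally show ?thesis .
  qed
  moreover have "(C + D ** F) *v v = 0" if "v \<in> span E" for v
    using linear_eq_on_span[of "(*v) (C + D ** F)" "\<lambda>_. 0" E v] that null by (simp add: module_hom_zero)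
  moreover have "spectrum_on (A + B ** F) (span E) \<subseteq> stability_region \<tau>"
    using spectrum_on_eigenbasis[OF E(2) eig] lw by blast
  ultimately show ?thesis
    unfolding stabilizability_output_nulling_def span_E by (auto intro!: exI[of _ F])
qed

text \<open>For \<open>v\<close> in \<open>V\<close>, let \<open>\<psi>\<close> be its component
  orthogonal to the claimed span. The functional \<open>\<psi>\<close> annihilates the span, and the
  polynomial argument shows that it annihilates \<open>V\<close> too; so \<open>\<psi>\<close> is
  orthogonal to both \<open>v\<close> and \<open>v - \<psi>\<close>, and vanishes.\<close>

lemma stabilizability_output_nulling_subset:
  fixes A :: "real^'n^'n" and B :: "real^'m^'n" and C :: "real^'n^'p" and D :: "real^'m^'p"
  assumes ri: "right_invertible A B C D"
    and mult: "\<forall>z \<in> invariant_zeros A B C D \<inter> stability_region \<tau>.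
           zero_algebraic_multiplicity A B C D z = zero_geometric_multiplicity A B C D z"
    and real: "invariant_zeros A B C D \<inter> stability_region \<tau> \<subseteq> \<real>"
    and V: "stabilizability_output_nulling \<tau> A B C D V"
  shows "V \<subseteq> span (stable_output_zeroing \<tau> A B C D)"
proof
  fix v assume "v \<in> V"
  define W where "W = stable_output_zeroing \<tau> A B C D"
  define P where "P = system_pencil A B C D"
  obtain F where sub: "subspace V" and inv: "\<And>v. v \<in> V \<Longrightarrow> (A + B ** F) *v v \<in> V"
    and null: "\<And>v. v \<in> V \<Longrightarrow> (C + D ** F) *v v = 0"
    and spec: "spectrum_on (A + B ** F) V \<subseteq> stability_region \<tau>"
    using V unfolding stabilizability_output_nulling_def by blast
  obtain y \<psi> where y: "y \<in> span W" and \<psi>: "\<And>w. w \<in> span W \<Longrightarrow> orthogonal \<psi> w" and v_eq: "v = y + \<psi>"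
    using orthogonal_subspace_decomp_exists[of W v] by metis
  define \<psi>0 where "\<psi>0 = (stack (\<chi> i. complex_of_real (\<psi> $ i)) 0 :: complex^('n + 'm))"
  have comb: "\<exists>\<eta>. \<forall>c. (\<Sum>r\<in>UNIV. \<eta> r * poly (P $ r $ c) (complex_of_real l)) = \<psi>0 $ c"
    if "complex_of_real l \<in> stability_region \<tau>" for l
    unfolding P_def \<psi>0_def
  proof (rule pencil_row_combination)
    fix u assume "u \<in> output_zeroing A B C D l"
    then have "u \<in> span W" using that by (intro span_base) (auto simp: W_def stable_output_zeroing_def)
    then show "\<psi> \<bullet> u = 0" using \<psi> by (simp add: orthogonal_def)
  qed
  have nr: "normal_rank P = CARD('n + 'p)"
    unfolding P_def by (rule right_invertible_normal_rank[OF ri])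
  obtain z0 where z0: "rank (eval_matrix P z0) = CARD('n + 'p)"
    unfolding P_def by (rule right_invertible_full_rank[OF ri])
  obtain g where g: "inj g" "det (\<chi> r c. eval_matrix P z0 $ r $ g c) \<noteq> 0"
    by (rule full_rank_column_selection[OF z0])
  have g': "det (\<chi> r c. P $ r $ g c) \<noteq> 0"
  proof
    assume "det (\<chi> r c. P $ r $ g c) = 0"
    then have "poly (det (\<chi> r c. P $ r $ g c)) z0 = 0" by simp
    then show False using g(2) by (simp add: poly_det eval_matrix_def)
  qed
  \<comment> \<open>The interval from -1 to 0 lies in the open left half-plane and in the open unit
    disc, so it supplies infinitely many stable real points in both time domains.\<close>
  have stable: "complex_of_real x \<in> stability_region \<tau>" if "-1 < x" "x < 0" for x
    using that by (cases \<tau>) (auto simp: stability_region_def)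
  have "infinite (complex_of_real ` {-1<..<0})"
    by (simp add: finite_image_iff inj_on_def)
  moreover have "\<exists>\<eta>. \<forall>c. (\<Sum>r\<in>UNIV. \<eta> r * poly (P $ r $ c) z) = \<psi>0 $ c"
    if "z \<in> complex_of_real ` {-1<..<0}" for z
    using that comb stable by auto
  \<comment> \<open>A stable point of deficient rank is an invariant zero. It is real by hypothesis,
    so \<open>comb\<close> applies there, and the equality of its multiplicities is the required
    order of the determinantal divisor.\<close>
  moreover have "order z (determinantal_divisor (CARD('n + 'p)) P) = CARD('n + 'p) - rank (eval_matrix P z) \<and>
      (\<exists>\<eta>. \<forall>c. (\<Sum>r\<in>UNIV. \<eta> r * poly (P $ r $ c) z) = \<psi>0 $ c)"
    if "z \<in> stability_region \<tau>" "rank (eval_matrix P z) \<noteq> CARD('n + 'p)" for z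
  proof -
    have z: "z \<in> invariant_zeros A B C D \<inter> stability_region \<tau>"
      using that not_invariant_zero_full_rank[OF ri] unfolding P_def by blast
    then obtain l where "z = complex_of_real l" using real by (auto elim: Reals_cases)
    then show ?thesis
      using comb that(1) mult[rule_format, OF z]
      unfolding zero_algebraic_multiplicity_def zero_geometric_multiplicity_def
        P_def[symmetric] by (auto simp: nr)
  qed
  ultimately obtain \<delta> q where \<delta>: "\<And>z. z \<in> stability_region \<tau> \<Longrightarrow> poly \<delta> z \<noteq> 0"
    and q: "\<And>c. (\<Sum>r\<in>UNIV. q $ r * P $ r $ c) = \<delta> * [:\<psi>0 $ c:]"
    by (rule polynomial_left_combination_no_roots[OF g(1) g']) blast+
  have "\<psi> \<bullet> v = 0"
  proof (rule functional_vanishes_on_invariant_subspace[OF sub inv, of \<delta> "\<chi> i. q $ Inl i"])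
    show "\<delta> \<noteq> 0" using \<delta>[OF stable[of "-1/2"]] by auto
    show "poly \<delta> z \<noteq> 0" if "z \<in> spectrum_on (A + B ** F) V" for z
      using that spec \<delta> by blast
    show "v \<in> V" by fact
    fix v assume v: "v \<in> V"
    \<comment> \<open>With the input \<open>F v\<close>, the pencil maps the constant vector
      \<open>(v, F v)\<close> to \<open>((A + B F - s) v, (C + D F) v)\<close>, whose lower block is
      zero on \<open>V\<close>. Multiplying by \<open>q\<close> from the left in the other order
      gives \<open>\<delta> (\<psi> \<bullet> v)\<close>.\<close>
    define x where "x = (\<chi> c. [:complex_of_real (stack v (F *v v) $ c):])"
    have P_Inl: "(\<Sum>c\<in>UNIV. P $ Inl i $ c * x $ c)
      = [:complex_of_real (((A + B ** F) *v v) $ i), - complex_of_real (v $ i):]" for i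
      unfolding poly_eq_poly_eq_iff[symmetric]
    proof
      fix z
      have "(\<Sum>j\<in>UNIV. (if i = j then z else 0) * complex_of_real (v $ j)) = z * complex_of_real (v $ i)"
        by (simp add: if_distrib[of "\<lambda>a. a * _"] cong: if_cong)
      moreover have "poly (if i = j then [:0, 1:] else 0) z = (if i = j then z else 0)" for j by simp
      ultimately show "poly (\<Sum>c\<in>UNIV. P $ Inl i $ c * x $ c) z
        = poly [:complex_of_real (((A + B ** F) *v v) $ i), - complex_of_real (v $ i):] z"
        unfolding closed_loop_mult P_def system_pencil_def x_def
        by (simp add: sum_UNIV_Plus poly_sum algebra_simps sum_subtractf matrix_vector_mult_def)
    qed
    have P_Inr: "(\<Sum>c\<in>UNIV. P $ Inr h $ c * x $ c) = [:complex_of_real (((C + D ** F) *v v) $ h):]" for h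
      unfolding poly_eq_poly_eq_iff[symmetric] closed_loop_mult P_def system_pencil_def x_def
      by (simp add: fun_eq_iff sum_UNIV_Plus poly_sum matrix_vector_mult_def mult.commute)
    define y where "y r = (\<Sum>c\<in>UNIV. P $ r $ c * x $ c)" for r
    have "(\<Sum>i\<in>UNIV. (\<chi> i. q $ Inl i) $ i * [:complex_of_real (((A + B ** F) *v v) $ i), - complex_of_real (v $ i):])
      = (\<Sum>r\<in>UNIV. q $ r * y r)"
      unfolding sum_UNIV_Plus by (simp add: y_def P_Inl P_Inr null[OF v])
    also have "\<dots> = (\<Sum>c\<in>UNIV. (\<Sum>r\<in>UNIV. q $ r * P $ r $ c) * x $ c)"
      unfolding y_def sum_distrib_left sum_distrib_right by (subst sum.swap) (simp only: mult.assoc)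
    also have "\<dots> = \<delta> * [:complex_of_real (\<psi> \<bullet> v):]"
      unfolding poly_eq_poly_eq_iff[symmetric] q x_def
      by (simp add: fun_eq_iff sum_UNIV_Plus poly_sum \<psi>0_def inner_vec_def sum_distrib_left mult.assoc
          del: mult_pCons_left mult_pCons_right)
    finally show "(\<Sum>i\<in>UNIV. (\<chi> i. q $ Inl i) $ i * [:complex_of_real (((A + B ** F) *v v) $ i), - complex_of_real (v $ i):])
      = \<delta> * [:complex_of_real (\<psi> \<bullet> v):]" .
  qed
  moreover have "\<psi> \<bullet> y = 0" using \<psi>[OF y] by (simp add: orthogonal_def)
  ultimately have "\<psi> = 0" by (simp add: v_eq inner_add_right)
  then show "v \<in> span (stable_output_zeroing \<tau> A B C D)" using y by (simp add: v_eq W_def)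
qed

theorem Vstar_g_eq_span:
  fixes A :: "real^'n^'n" and B :: "real^'m^'n" and C :: "real^'n^'p" and D :: "real^'m^'p"
  assumes "right_invertible A B C D"
    and "\<forall>z \<in> invariant_zeros A B C D \<inter> stability_region \<tau>.
           zero_algebraic_multiplicity A B C D z = zero_geometric_multiplicity A B C D z"
    and "invariant_zeros A B C D \<inter> stability_region \<tau> \<subseteq> \<real>"
  shows "Vstar_g \<tau> A B C D = span (stable_output_zeroing \<tau> A B C D)"
  unfolding Vstar_g_def
  by (rule Greatest_equality, rule span_stable_output_zeroing,
      rule stabilizability_output_nulling_subset[OF assms])

subsection \<open>Closed-loop trajectories\<close>

lemma mode_evolves: "evolves \<tau> (mode \<tau> l) (\<lambda>t. l * mode \<tau> l t)"
proof (cases \<tau>)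
  case Continuous
  have "((\<lambda>t. exp (l * t)) has_vector_derivative l * exp (l * t)) (at t within {0..})" for t
    unfolding has_real_derivative_iff_has_vector_derivative[symmetric]
    by (auto intro!: derivative_eq_intros)
  moreover have "mode Continuous l = (\<lambda>t. exp (l * t))" by (simp add: mode_def fun_eq_iff)
  ultimately show ?thesis by (simp add: Continuous evolves_def time_set_def)
next
  case Discrete
  then show ?thesis by (auto simp: evolves_def mode_def time_set_def elim!: Nats_cases
      simp: nat_add_distrib)
qed

lemma evolves_linear_image:
  assumes "bounded_linear f" and "evolves \<tau> x g"
  shows "evolves \<tau> (\<lambda>t. f (x t)) (\<lambda>t. f (g t))"
  using assms(2) by (cases \<tau>) (simp_all add: evolves_def bounded_linear.has_vector_derivative[OF assms(1)])

lemma evolves_sum: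
  assumes "\<And>k. k \<in> J \<Longrightarrow> evolves \<tau> (x k) (g k)"
  shows "evolves \<tau> (\<lambda>t. \<Sum>k\<in>J. x k t) (\<lambda>t. \<Sum>k\<in>J. g k t)"
  using assms by (cases \<tau>) (auto simp: evolves_def intro!: has_vector_derivative_sum sum.cong)

text \<open>In continuous time, multiplication by the integrating factor
  \<open>exp (- l * s)\<close> makes the solution constant; in discrete time the formula is a
  recursion.\<close>

lemma evolves_scalar_solution:
  assumes "evolves \<tau> x (\<lambda>t. l * x t)" and "t \<in> time_set \<tau>"
  shows "x t = x 0 * mode \<tau> l t"
proof (cases \<tau>)
  case Continuous
  define S where "S = {0::real..}"
  have x: "(x has_real_derivative l * x s) (at s within S)" if "s \<in> S" for s
    using assms(1) that unfolding has_real_derivative_iff_has_vector_derivative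
    by (simp add: Continuous evolves_def time_set_def S_def)
  have "((\<lambda>s. exp (- l * s) * x s) has_real_derivative 0) (at s within S)" if "s \<in> S" for s
  proof -
    have "((\<lambda>s. exp (- l * s)) has_real_derivative exp (- l * s) * - l) (at s within S)"
      by (auto intro!: derivative_eq_intros)
    from DERIV_mult[OF this x[OF that]] show ?thesis by (simp add: algebra_simps)
  qed
  then have "\<exists>c. \<forall>s\<in>S. exp (- l * s) * x s = c"
    by (intro has_field_derivative_zero_constant) (simp_all add: S_def)
  then obtain c where c: "\<And>s. s \<in> S \<Longrightarrow> exp (- l * s) * x s = c" by blast
  have "0 \<in> S" "t \<in> S" using assms(2) by (simp_all add: S_def Continuous time_set_def)
  then have "exp (- l * t) * x t = x 0" using c[of t] c[of 0] by simp
  then show ?thesis by (simp add: Continuous mode_def exp_minus field_simps)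
next
  case Discrete
  have "x (real n) = x 0 * l ^ n" for n
  proof (induction n)
    case (Suc n)
    have "x (real n + 1) = l * x (real n)"
      using assms(1) by (simp add: Discrete evolves_def time_set_def)
    then show ?case using Suc by (simp add: add.commute)
  qed simp
  then show ?thesis using assms(2) by (auto simp: Discrete mode_def time_set_def elim!: Nats_cases)
qed

lemma mode_tendsto_0:
  assumes "complex_of_real l \<in> stability_region \<tau>"
  shows "(mode \<tau> l \<longlongrightarrow> 0) (time_at_top \<tau>)"
proof (rule tendsto_mono)
  show "time_at_top \<tau> \<le> at_top" by (simp add: time_at_top_def)
  show "(mode \<tau> l \<longlongrightarrow> 0) at_top"
  proof (cases \<tau>)
    case Continuous
    then have "l < 0" using assms by (simp add: stability_region_def)
    then have "filterlim (\<lambda>t. l * t) at_bot at_top"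
      by (intro filterlim_tendsto_neg_mult_at_bot[OF tendsto_const] filterlim_ident)
    then show ?thesis
      unfolding mode_def Continuous by (auto intro: filterlim_compose[OF exp_at_bot])
  next
    case Discrete
    then have "\<bar>l\<bar> < 1" using assms by (simp add: stability_region_def)
    then have "(\<lambda>n. l ^ n) \<longlonglongrightarrow> 0" by (simp add: LIMSEQ_power_zero)
    moreover have "filterlim (\<lambda>t::real. nat \<lfloor>t\<rfloor>) sequentially at_top"
      by (intro filterlim_compose[OF filterlim_nat_sequentially] filterlim_floor_sequentially)
    ultimately show ?thesis
      unfolding mode_def Discrete by (auto intro: filterlim_compose)
  qed
qed

lemma eventually_time_set: "eventually (\<lambda>t. t \<in> time_set \<tau>) (time_at_top \<tau>)"
  by (simp add: time_at_top_def eventually_inf_principal)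

lemma eigenmodes_evolve:
  fixes M :: "real^'n^'n" and \<tau> :: time_domain and a :: "'k \<Rightarrow> real"
  assumes "\<And>k. k \<in> J \<Longrightarrow> M *v v k = l k *\<^sub>R v k"
  defines "\<xi> \<equiv> \<lambda>t. \<Sum>k\<in>J. (a k * mode \<tau> (l k) t) *\<^sub>R v k"
  shows "evolves \<tau> \<xi> (\<lambda>t. M *v \<xi> t)"
proof -
  have "evolves \<tau> (\<lambda>t. (a k * mode \<tau> (l k) t) *\<^sub>R v k) (\<lambda>t. (a k * (l k * mode \<tau> (l k) t)) *\<^sub>R v k)" for k
    by (rule evolves_linear_image[of "\<lambda>c. (a k * c) *\<^sub>R v k", OF _ mode_evolves])
      (intro bounded_linear_compose[OF bounded_linear_scaleR_left bounded_linear_mult_right])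
  then have "evolves \<tau> \<xi> (\<lambda>t. \<Sum>k\<in>J. (a k * (l k * mode \<tau> (l k) t)) *\<^sub>R v k)"
    unfolding \<xi>_def by (rule evolves_sum)
  moreover have "(\<lambda>t. \<Sum>k\<in>J. (a k * (l k * mode \<tau> (l k) t)) *\<^sub>R v k) = (\<lambda>t. M *v \<xi> t)"
    unfolding \<xi>_def
    by (intro ext) (simp add: linear_sum[OF matrix_vector_mul_linear] matrix_vector_mult_scaleR assms(1) mult_ac cong: sum.cong)
  ultimately show ?thesis by simp
qed

text \<open>In eigenbasis coordinates the system splits into scalar equations, each solved by its
  mode; the coefficients are the coordinates of the initial state.\<close>

lemma eigenbasis_solution:
  fixes M :: "real^'n^'n"
  assumes inj: "inj_on v J" and ind: "independent (v ` J)" and span: "span (v ` J) = UNIV"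
    and eig: "\<And>k. k \<in> J \<Longrightarrow> M *v v k = l k *\<^sub>R v k"
    and \<xi>: "evolves \<tau> \<xi> (\<lambda>t. M *v \<xi> t)"
  shows "\<exists>a. \<forall>t\<in>time_set \<tau>. \<xi> t = (\<Sum>k\<in>J. (a k * mode \<tau> (l k) t) *\<^sub>R v k)"
proof -
  obtain \<phi> where \<phi>: "\<And>b. linear (\<phi> b)" "\<And>b e. e \<in> v ` J \<Longrightarrow> \<phi> b e = (if e = b then 1 else 0 :: real)"
    and coords: "\<And>x. x \<in> span (v ` J) \<Longrightarrow> x = (\<Sum>b\<in>v ` J. \<phi> b x *\<^sub>R b)"
    using coordinate_functionals[OF ind] by blast
  have M_\<phi>: "\<phi> (v k) (M *v x) = l k * \<phi> (v k) x" if "k \<in> J" for k x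
  proof (rule linear_eq_on_span[of _ _ "v ` J"])
    show "linear (\<lambda>x. \<phi> (v k) (M *v x))"
      using linear_compose[OF matrix_vector_mul_linear \<phi>(1)] by (simp add: o_def)
    show "linear (\<lambda>x. l k * \<phi> (v k) x)"
      using linear_compose_scale_right[OF \<phi>(1)] by simp
    show "\<phi> (v k) (M *v e) = l k * \<phi> (v k) e" if "e \<in> v ` J" for e
      using that \<open>k \<in> J\<close> inj_onD[OF inj] by (auto simp: eig linear_scale[OF \<phi>(1)] \<phi>(2))
    show "x \<in> span (v ` J)" by (simp add: span)
  qed
  show ?thesis
  proof (intro exI[of _ "\<lambda>k. \<phi> (v k) (\<xi> 0)"] ballI)
    fix t assume t: "t \<in> time_set \<tau>"
    have "\<phi> (v k) (\<xi> t) = \<phi> (v k) (\<xi> 0) * mode \<tau> (l k) t" if "k \<in> J" for k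
    proof (rule evolves_scalar_solution[OF _ t])
      have "bounded_linear (\<phi> (v k))" using \<phi>(1) by (simp add: linear_conv_bounded_linear)
      from evolves_linear_image[OF this \<xi>]
      show "evolves \<tau> (\<lambda>t. \<phi> (v k) (\<xi> t)) (\<lambda>t. l k * \<phi> (v k) (\<xi> t))"
        by (simp add: M_\<phi>[OF that])
    qed
    then show "\<xi> t = (\<Sum>k\<in>J. (\<phi> (v k) (\<xi> 0) * mode \<tau> (l k) t) *\<^sub>R v k)"
      using coords[of "\<xi> t"] by (simp add: span sum.reindex[OF inj] cong: sum.cong)
  qed
qed

lemma eigenbasis_tendsto_0:
  fixes M :: "real^'n^'n"
  assumes basis: "inj_on v J" "independent (v ` J)" "span (v ` J) = UNIV"
    and eig: "\<And>k. k \<in> J \<Longrightarrow> M *v v k = l k *\<^sub>R v k"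
    and stable: "\<And>k. k \<in> J \<Longrightarrow> complex_of_real (l k) \<in> stability_region \<tau>"
    and \<xi>: "evolves \<tau> \<xi> (\<lambda>t. M *v \<xi> t)"
  shows "(\<xi> \<longlongrightarrow> 0) (time_at_top \<tau>)"
proof -
  have "\<exists>a. \<forall>t\<in>time_set \<tau>. \<xi> t = (\<Sum>k\<in>J. (a k * mode \<tau> (l k) t) *\<^sub>R v k)"
    by (rule eigenbasis_solution[OF basis eig \<xi>])
  then obtain a where a: "\<forall>t\<in>time_set \<tau>. \<xi> t = (\<Sum>k\<in>J. (a k * mode \<tau> (l k) t) *\<^sub>R v k)"
    by (elim exE)
  have "((\<lambda>t. \<Sum>k\<in>J. (a k * mode \<tau> (l k) t) *\<^sub>R v k) \<longlongrightarrow> 0) (time_at_top \<tau>)"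
  proof (rule tendsto_null_sum)
    fix k assume "k \<in> J"
    have "((\<lambda>t. (a k * mode \<tau> (l k) t) *\<^sub>R v k) \<longlongrightarrow> (a k * 0) *\<^sub>R v k) (time_at_top \<tau>)"
      by (intro tendsto_scaleR tendsto_mult tendsto_const mode_tendsto_0 stable \<open>k \<in> J\<close>)
    then show "((\<lambda>t. (a k * mode \<tau> (l k) t) *\<^sub>R v k) \<longlongrightarrow> 0) (time_at_top \<tau>)" by simp
  qed
  then show ?thesis
    by (rule Lim_transform_eventually, intro eventually_mono[OF eventually_time_set]) (simp add: a)
qed

section \<open>Static gain and asymptotic tracking\<close>

lemma matrix_inv_mult:
  assumes "invertible K"
  shows "K ** matrix_inv K = mat 1" "matrix_inv K ** K = mat 1"
  using someI_ex[OF assms[unfolded invertible_def]] by (simp_all add: matrix_inv_def)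

text \<open>The number \<open>s\<close> such that \<open>s x = A x + B u\<close> describes the equilibria for constant \<open>u\<close>.\<close>

definition reference_eigenvalue :: "time_domain \<Rightarrow> real" where
  "reference_eigenvalue \<tau> = (case \<tau> of Continuous \<Rightarrow> 0 | Discrete \<Rightarrow> 1)"

text \<open>The reference eigenvalue lies outside the stability region, so \<open>K\<close> is
  invertible and the \<open>matrix_inv\<close> in the static gain is a true inverse. Hence each
  constant input has exactly one equilibrium, and the gain maps the input to the output
  there.\<close>

lemma static_gain_solution:
  fixes A :: "real^'n^'n" and B :: "real^'m^'n" and C :: "real^'n^'p" and D :: "real^'m^'p"
  assumes stable: "spectrum (A + B ** F) \<subseteq> stability_region \<tau>"
  defines "s \<equiv> reference_eigenvalue \<tau>"
  shows "\<exists>x. (A + B ** F) *v x + B *v u = s *\<^sub>R x \<and> static_gain \<tau> A B C D F *v u = (C + D ** F) *v x + D *v u"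
    and "(A + B ** F) *v x + B *v u = s *\<^sub>R x \<Longrightarrow> static_gain \<tau> A B C D F *v u = (C + D ** F) *v x + D *v u"
proof -
  define K where "K = s *\<^sub>R mat 1 - (A + B ** F)"
  have K_mult: "K *v x = s *\<^sub>R x - (A + B ** F) *v x" for x
    by (simp add: K_def matrix_vector_mult_diff_rdistrib scaleR_matrix_vector_assoc[symmetric])
  have K_case: "(case \<tau> of Continuous \<Rightarrow> - (A + B ** F) | Discrete \<Rightarrow> mat 1 - (A + B ** F)) = K"
    by (cases \<tau>) (simp_all add: K_def s_def reference_eigenvalue_def)
  have "complex_of_real s \<notin> stability_region \<tau>"
    by (cases \<tau>) (simp_all add: s_def reference_eigenvalue_def stability_region_def)
  then have "x = 0" if "K *v x = 0" for x
    using that stable eigenvalue_in_spectrum_on[of "A + B ** F" x s UNIV] by (auto simp: K_mult)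
  then have "invertible K"
    unfolding invertible_left_inverse matrix_left_invertible_ker by blast
  then have inv: "matrix_inv K *v (K *v x) = x" "K *v (matrix_inv K *v x) = x" for x
    by (simp_all add: matrix_vector_mul_assoc matrix_inv_mult[OF \<open>invertible K\<close>])
  have gain: "static_gain \<tau> A B C D F *v u = (C + D ** F) *v (matrix_inv K *v (B *v u)) + D *v u"
    unfolding static_gain_def K_case
    by (simp add: matrix_vector_mult_add_rdistrib matrix_vector_mul_assoc[symmetric])
  show "static_gain \<tau> A B C D F *v u = (C + D ** F) *v x + D *v u"
    if "(A + B ** F) *v x + B *v u = s *\<^sub>R x" for x
  proof -
    have "K *v x = B *v u" using that by (simp add: K_mult algebra_simps flip: that)
    then show ?thesis using inv(1)[of x] gain by simp
  qed
  show "\<exists>x. (A + B ** F) *v x + B *v u = s *\<^sub>R x \<and> static_gain \<tau> A B C D F *v u = (C + D ** F) *v x + D *v u"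
    using gain inv(2)[of "B *v u"] by (intro exI[of _ "matrix_inv K *v (B *v u)"]) (simp add: K_mult algebra_simps)
qed

text \<open>Since the reference eigenvalue is not an invariant zero, every output \<open>e\<close>
  is attained at an open-loop equilibrium \<open>(x, w)\<close>. Under the feedback the
  corresponding external input is \<open>w - F x\<close>.\<close>

lemma static_gain_right_inverse:
  fixes A :: "real^'n^'n" and B :: "real^'m^'n" and C :: "real^'n^'p" and D :: "real^'m^'p"
  assumes ri: "right_invertible A B C D"
    and s: "complex_of_real (reference_eigenvalue \<tau>) \<notin> invariant_zeros A B C D"
    and stable: "spectrum (A + B ** F) \<subseteq> stability_region \<tau>"
  shows "\<exists>G :: real^'p^'m. static_gain \<tau> A B C D F ** G = mat 1"
  unfolding matrix_right_invertible_surjective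
  unfolding surj_def
proof
  fix e :: "real^'p"
  obtain x w where xw: "(A - reference_eigenvalue \<tau> *\<^sub>R mat 1) *v x + B *v w = 0" "C *v x + D *v w = e"
    by (rule pencil_surj[OF ri s])
  have "(A + B ** F) *v x + B *v (w - F *v x) = reference_eigenvalue \<tau> *\<^sub>R x"
    using xw(1) unfolding eigenvector_pencil_iff[symmetric] closed_loop_mult
    by (simp add: matrix_vector_mult_diff_distrib)
  then have "static_gain \<tau> A B C D F *v (w - F *v x) = (C + D ** F) *v x + D *v (w - F *v x)"
    by (rule static_gain_solution(2)[OF stable])
  also have "\<dots> = e"
    using xw(2) by (simp add: closed_loop_mult matrix_vector_mult_diff_distrib)
  finally have "static_gain \<tau> A B C D F *v (w - F *v x) = e" .
  then show "\<exists>u. e = static_gain \<tau> A B C D F *v u" by metis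
qed

text \<open>The choice of \<open>G\<close> makes \<open>rbar\<close> the output at the closed-loop
  equilibrium \<open>x0\<close>. The deviation \<open>x - x0\<close> obeys the autonomous
  closed-loop system and decays.\<close>

lemma eigenbasis_tracks:
  fixes A :: "real^'n^'n" and B :: "real^'m^'n" and C :: "real^'n^'p" and D :: "real^'m^'p"
  assumes basis: "inj_on v J" "independent (v ` J)" "span (v ` J) = UNIV"
    and eig: "\<And>k. k \<in> J \<Longrightarrow> (A + B ** F) *v v k = l k *\<^sub>R v k"
    and l: "\<And>k. k \<in> J \<Longrightarrow> complex_of_real (l k) \<in> stability_region \<tau>"
    and stable: "spectrum (A + B ** F) \<subseteq> stability_region \<tau>"
    and G: "static_gain \<tau> A B C D F ** G = mat 1"
  shows "tracks_constant_references \<tau> A B C D F G"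
  unfolding tracks_constant_references_def
proof (intro allI impI)
  fix rbar :: "real^'p" and x :: "real \<Rightarrow> real^'n" and u :: "real \<Rightarrow> real^'m" and y :: "real \<Rightarrow> real^'p"
  assume u: "\<forall>t. u t = F *v x t + G *v rbar" and y: "\<forall>t. y t = C *v x t + D *v u t"
    and x: "evolves \<tau> x (\<lambda>t. A *v x t + B *v u t)"
  define M where "M = A + B ** F"
  obtain x0 where x0: "M *v x0 + B *v (G *v rbar) = reference_eigenvalue \<tau> *\<^sub>R x0"
    and gain: "static_gain \<tau> A B C D F *v (G *v rbar) = (C + D ** F) *v x0 + D *v (G *v rbar)"
    using static_gain_solution(1)[OF stable] unfolding M_def by blast
  have rbar: "rbar = (C + D ** F) *v x0 + D *v (G *v rbar)"
    using gain by (simp add: matrix_vector_mul_assoc G)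
  have rhs: "A *v x t + B *v u t = M *v (x t - x0) + reference_eigenvalue \<tau> *\<^sub>R x0" for t
    unfolding x0[symmetric] using u
    by (simp add: M_def closed_loop_mult matrix_vector_mult_diff_distrib matrix_vector_right_distrib
        matrix_vector_mul_assoc algebra_simps)
  \<comment> \<open>The extra term in \<open>rhs\<close> is zero in continuous time; in discrete
    time it equals \<open>x0\<close> and cancels against the shift of the constant.\<close>
  have "evolves \<tau> (\<lambda>t. x t - x0) (\<lambda>t. M *v (x t - x0))"
  proof (cases \<tau>)
    case Continuous
    then show ?thesis using x unfolding rhs
      by (auto simp: evolves_def reference_eigenvalue_def intro!: derivative_eq_intros)
  next
    case Discrete
    then show ?thesis using x unfolding rhs by (auto simp: evolves_def reference_eigenvalue_def)
  qed
  then have "((\<lambda>t. x t - x0) \<longlongrightarrow> 0) (time_at_top \<tau>)"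
    using eigenbasis_tendsto_0[OF basis eig l] unfolding M_def by blast
  then have "((\<lambda>t. (C + D ** F) *v (x t - x0) + rbar) \<longlongrightarrow> (C + D ** F) *v 0 + rbar) (time_at_top \<tau>)"
    by (intro tendsto_intros bounded_linear.tendsto[OF matrix_vector_mul_bounded_linear])
  moreover have "y = (\<lambda>t. (C + D ** F) *v (x t - x0) + rbar)"
    using y u by (intro ext, subst rbar)
      (simp add: closed_loop_mult matrix_vector_mult_diff_distrib matrix_vector_right_distrib)
  ultimately show "(y \<longlongrightarrow> rbar) (time_at_top \<tau>)" by simp
qed

section \<open>Decoupled modes from an eigenvector basis\<close>

lemma finite_mode_index: "finite (mode_index \<nu>0 (\<nu> :: 'p::finite \<Rightarrow> nat))"
  unfolding mode_index_def by (rule finite_SigmaI) auto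

lemma card_mode_index: "card (mode_index \<nu>0 (\<nu> :: 'p::finite \<Rightarrow> nat)) = \<nu>0 + (\<Sum>i\<in>UNIV. \<nu> i)"
proof -
  have "card (mode_index \<nu>0 \<nu>) = (\<Sum>k\<in>UNIV. case k of None \<Rightarrow> \<nu>0 | Some i \<Rightarrow> \<nu> i)"
    by (simp add: mode_index_def)
  also have "\<dots> = \<nu>0 + (\<Sum>i\<in>UNIV. \<nu> i)"
    by (simp add: UNIV_option_conv sum.reindex)
  finally show ?thesis .
qed

lemma eigenbasis_decoupled:
  fixes A :: "real^'n^'n" and B :: "real^'m^'n" and C :: "real^'n^'p" and D :: "real^'m^'p"
    and \<nu> :: "'p \<Rightarrow> nat"
  assumes "has_decoupling_eigenbasis A B C D F \<nu>0 \<nu> \<mu>"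
  shows "state_to_output_decoupled \<tau> A B C D F \<nu> \<mu>"
proof -
  define J where "J = mode_index \<nu>0 \<nu>"
  obtain \<mu>0 v where *: "inj_on v J \<and> independent (v ` J) \<and> span (v ` J) = UNIV \<and>
        (\<forall>j\<in>{1..\<nu>0}. (A + B ** F) *v v (None, j) = \<mu>0 j *\<^sub>R v (None, j) \<and>
           (C + D ** F) *v v (None, j) = 0) \<and>
        (\<forall>i. \<forall>j\<in>{1..\<nu> i}. (A + B ** F) *v v (Some i, j) = \<mu> i j *\<^sub>R v (Some i, j) \<and>
           (\<exists>c. c \<noteq> 0 \<and> (C + D ** F) *v v (Some i, j) = c *\<^sub>R axis i 1))"
    using assms unfolding has_decoupling_eigenbasis_def J_def by (elim exE)
  then have basis: "inj_on v J" "independent (v ` J)" "span (v ` J) = UNIV" by simp_all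
  have v0: "(A + B ** F) *v v (None, j) = \<mu>0 j *\<^sub>R v (None, j)" "(C + D ** F) *v v (None, j) = 0"
    if "j \<in> {1..\<nu>0}" for j using * that by simp_all
  have v1: "(A + B ** F) *v v (Some i, j) = \<mu> i j *\<^sub>R v (Some i, j)"
    "\<exists>c. c \<noteq> 0 \<and> (C + D ** F) *v v (Some i, j) = c *\<^sub>R axis i 1"
    if "j \<in> {1..\<nu> i}" for i j using * that by simp_all
  define l where "l k = (case k of (None, j) \<Rightarrow> \<mu>0 j | (Some i, j) \<Rightarrow> \<mu> i j)" for k
  define c where "c i j = (SOME c. c \<noteq> 0 \<and> (C + D ** F) *v v (Some i, j) = c *\<^sub>R axis i 1)" for i j
  have c: "c i j \<noteq> 0 \<and> (C + D ** F) *v v (Some i, j) = c i j *\<^sub>R axis i 1" if "j \<in> {1..\<nu> i}" for i j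
    unfolding c_def by (rule someI_ex) (rule v1(2)[OF that])
  have eig: "(A + B ** F) *v v k = l k *\<^sub>R v k" if "k \<in> J" for k
    using that v0 v1 by (auto simp: J_def mode_index_def l_def split: option.splits)
  have out: "((C + D ** F) *v v (k, j)) $ i = (if k = Some i then c i j else 0)"
    if "(k, j) \<in> J" for k i j
    using that v0 c by (auto simp: J_def mode_index_def axis_def split: option.splits)
  have J_eq: "J = Sigma UNIV (\<lambda>k. {1..(case k of None \<Rightarrow> \<nu>0 | Some i \<Rightarrow> \<nu> i)})"
    by (simp add: J_def mode_index_def)
  \<comment> \<open>Eigenvectors with first index \<open>Some i\<close> are the only ones that
    contribute to output \<open>i\<close>, so the sum over the basis collapses to the modes of that
    channel, with coefficients scaled by the nonzero \<open>c i j\<close>.\<close>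
  have modes: "((C + D ** F) *v (\<Sum>k\<in>J. (a k * mode \<tau> (l k) t) *\<^sub>R v k)) $ i
    = (\<Sum>j = 1..\<nu> i. (a (Some i, j) * c i j) * mode \<tau> (\<mu> i j) t)" for a t i
  proof -
    have "((C + D ** F) *v (\<Sum>k\<in>J. (a k * mode \<tau> (l k) t) *\<^sub>R v k)) $ i
      = (\<Sum>k\<in>J. a k * mode \<tau> (l k) t * ((C + D ** F) *v v k) $ i)"
      by (simp add: linear_sum[OF matrix_vector_mul_linear] matrix_vector_mult_scaleR)
    also have "\<dots> = (\<Sum>(k, j)\<in>J. if k = Some i then a (Some i, j) * c i j * mode \<tau> (\<mu> i j) t else 0)"
      by (intro sum.cong refl) (auto simp: out l_def)
    also have "\<dots> = (\<Sum>k\<in>UNIV. \<Sum>j = 1..(case k of None \<Rightarrow> \<nu>0 | Some i \<Rightarrow> \<nu> i).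
        if k = Some i then a (Some i, j) * c i j * mode \<tau> (\<mu> i j) t else 0)"
      unfolding J_eq by (subst sum.Sigma) auto
    also have "\<dots> = (\<Sum>k\<in>UNIV. if k = Some i then \<Sum>j = 1..\<nu> i. a (Some i, j) * c i j * mode \<tau> (\<mu> i j) t else 0)"
      by (intro sum.cong refl) auto
    finally show ?thesis by simp
  qed
  show ?thesis
    unfolding state_to_output_decoupled_def Let_def
  proof (intro conjI allI impI)
    fix \<xi> assume "evolves \<tau> \<xi> (\<lambda>t. (A + B ** F) *v \<xi> t)"
    then have "\<exists>a. \<forall>t\<in>time_set \<tau>. \<xi> t = (\<Sum>k\<in>J. (a k * mode \<tau> (l k) t) *\<^sub>R v k)"
      using eigenbasis_solution[OF basis eig] by simp
    then obtain a where a: "\<forall>t\<in>time_set \<tau>. \<xi> t = (\<Sum>k\<in>J. (a k * mode \<tau> (l k) t) *\<^sub>R v k)"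
      by (elim exE)
    show "\<exists>\<beta>. \<forall>i. \<forall>t\<in>time_set \<tau>. ((C + D ** F) *v \<xi> t) $ i = (\<Sum>j = 1..\<nu> i. \<beta> i j * mode \<tau> (\<mu> i j) t)"
      by (intro exI[of _ "\<lambda>i j. a (Some i, j) * c i j"] allI ballI) (simp only: a[rule_format] modes)
  next
    fix \<beta> :: "'p \<Rightarrow> nat \<Rightarrow> real"
    \<comment> \<open>Division by \<open>c i j\<close> inverts this scaling; the unobservable modes
      may be left unexcited.\<close>
    define a where "a = (\<lambda>k. case k of (None, j) \<Rightarrow> 0 | (Some i, j) \<Rightarrow> \<beta> i j / c i j)"
    show "\<exists>\<xi>. evolves \<tau> \<xi> (\<lambda>t. (A + B ** F) *v \<xi> t) \<and>
      (\<forall>i. \<forall>t\<in>time_set \<tau>. ((C + D ** F) *v \<xi> t) $ i = (\<Sum>j = 1..\<nu> i. \<beta> i j * mode \<tau> (\<mu> i j) t))"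
    proof (intro exI[of _ "\<lambda>t. \<Sum>k\<in>J. (a k * mode \<tau> (l k) t) *\<^sub>R v k"] conjI allI ballI)
      show "evolves \<tau> (\<lambda>t. \<Sum>k\<in>J. (a k * mode \<tau> (l k) t) *\<^sub>R v k)
        (\<lambda>t. (A + B ** F) *v (\<Sum>k\<in>J. (a k * mode \<tau> (l k) t) *\<^sub>R v k))"
        by (rule eigenmodes_evolve[OF eig])
      show "((C + D ** F) *v (\<Sum>k\<in>J. (a k * mode \<tau> (l k) t) *\<^sub>R v k)) $ i
        = (\<Sum>j = 1..\<nu> i. \<beta> i j * mode \<tau> (\<mu> i j) t)" for i t
        unfolding modes using c by (intro sum.cong refl) (simp add: a_def)
    qed
  qed
qed

subsection \<open>Decoupling eigenvector bases\<close>

text \<open>These are the vectors of \<open>R_sub\<close> admitting an input with nonzero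
  \<open>i\<close>-th output. The condition \<open>c \<noteq> 0\<close> is what the eigenbasis
  demands, but it makes the set fail to be a subspace; Rado's theorem works with arbitrary sets, so
  only the span has to be right.\<close>

definition decoupling_directions ::
  "real^'n^'n \<Rightarrow> real^'m^'n \<Rightarrow> real^'n^'p \<Rightarrow> real^'m^'p \<Rightarrow> 'p \<Rightarrow> real \<Rightarrow> (real^'n) set" where
  "decoupling_directions A B C D i l =
     {v. \<exists>w c. (A - l *\<^sub>R mat 1) *v v + B *v w = 0 \<and> c \<noteq> 0 \<and> C *v v + D *v w = c *\<^sub>R axis i 1}"

lemma subspace_R_sub: "subspace (R_sub A B C D i l)"
  unfolding subspace_def
proof (intro conjI ballI allI)
  show "0 \<in> R_sub A B C D i l"
    unfolding R_sub_def by (intro CollectI exI[of _ 0]) simp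
next
  fix x y assume "x \<in> R_sub A B C D i l" "y \<in> R_sub A B C D i l"
  then obtain v w where vw: "(A - l *\<^sub>R mat 1) *v x + B *v v = 0" "(A - l *\<^sub>R mat 1) *v y + B *v w = 0"
    "\<forall>k. k \<noteq> i \<longrightarrow> (C *v x + D *v v) $ k = 0" "\<forall>k. k \<noteq> i \<longrightarrow> (C *v y + D *v w) $ k = 0"
    by (auto simp: R_sub_def)
  have eqs: "(A - l *\<^sub>R mat 1) *v (x + y) + B *v (v + w) =
      ((A - l *\<^sub>R mat 1) *v x + B *v v) + ((A - l *\<^sub>R mat 1) *v y + B *v w)"
    "C *v (x + y) + D *v (v + w) = (C *v x + D *v v) + (C *v y + D *v w)"
    by (simp_all add: matrix_vector_right_distrib algebra_simps)
  show "x + y \<in> R_sub A B C D i l"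
    unfolding R_sub_def
  proof (intro CollectI exI[of _ "v + w"] conjI allI impI)
    show "(A - l *\<^sub>R mat 1) *v (x + y) + B *v (v + w) = 0" unfolding eqs(1) vw by simp
    show "(C *v (x + y) + D *v (v + w)) $ k = 0" if "k \<noteq> i" for k
      unfolding eqs(2) using vw(3,4) that by (simp only: vector_add_component) simp
  qed
next
  fix a x assume "x \<in> R_sub A B C D i l"
  then obtain w where w: "(A - l *\<^sub>R mat 1) *v x + B *v w = 0"
    "\<forall>k. k \<noteq> i \<longrightarrow> (C *v x + D *v w) $ k = 0"
    by (auto simp: R_sub_def)
  have eqs: "(A - l *\<^sub>R mat 1) *v (a *\<^sub>R x) + B *v (a *\<^sub>R w) = a *\<^sub>R ((A - l *\<^sub>R mat 1) *v x + B *v w)"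
    "C *v (a *\<^sub>R x) + D *v (a *\<^sub>R w) = a *\<^sub>R (C *v x + D *v w)"
    by (simp_all only: matrix_vector_mult_scaleR scaleR_right_distrib)
  show "a *\<^sub>R x \<in> R_sub A B C D i l"
    unfolding R_sub_def
  proof (intro CollectI exI[of _ "a *\<^sub>R w"] conjI allI impI)
    show "(A - l *\<^sub>R mat 1) *v (a *\<^sub>R x) + B *v (a *\<^sub>R w) = 0" unfolding eqs(1) w by simp
    show "(C *v (a *\<^sub>R x) + D *v (a *\<^sub>R w)) $ k = 0" if "k \<noteq> i" for k
      unfolding eqs(2) using w(2) that by (simp only: vector_scaleR_component) simp
  qed
qed

lemma R_subE:
  assumes "v \<in> R_sub A B C D i l"
  obtains w c where "(A - l *\<^sub>R mat 1) *v v + B *v w = 0" "C *v v + D *v w = c *\<^sub>R axis i 1"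
proof -
  obtain w where w: "(A - l *\<^sub>R mat 1) *v v + B *v w = 0" "\<forall>k. k \<noteq> i \<longrightarrow> (C *v v + D *v w) $ k = 0"
    using assms by (auto simp: R_sub_def)
  have "C *v v + D *v w = ((C *v v + D *v w) $ i) *\<^sub>R axis i 1"
    using w(2) by (simp add: vec_eq_iff axis_def)
  with w(1) show ?thesis by (rule that)
qed

lemma decoupling_directions_subset: "decoupling_directions A B C D i l \<subseteq> R_sub A B C D i l"
proof
  fix v assume "v \<in> decoupling_directions A B C D i l"
  then obtain w c where w: "(A - l *\<^sub>R mat 1) *v v + B *v w = 0" "C *v v + D *v w = c *\<^sub>R axis i 1"
    by (auto simp: decoupling_directions_def)
  show "v \<in> R_sub A B C D i l"
    unfolding R_sub_def
  proof (intro CollectI exI[of _ w] conjI w(1) allI impI)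
    show "(C *v v + D *v w) $ k = 0" if "k \<noteq> i" for k
      unfolding w(2) using that by (simp add: axis_def)
  qed
qed

text \<open>A vector of \<open>R_i(l)\<close> that belongs to the output-zeroing directions is the difference of two
  vectors with nonzero output, as \<open>l\<close> is not an invariant zero.\<close>

lemma span_decoupling_directions:
  assumes "right_invertible A B C D" "complex_of_real l \<notin> invariant_zeros A B C D"
  shows "span (decoupling_directions A B C D i l) = R_sub A B C D i l"
proof (rule subset_antisym)
  show "span (decoupling_directions A B C D i l) \<subseteq> R_sub A B C D i l"
    by (rule span_minimal[OF decoupling_directions_subset subspace_R_sub])
  show "R_sub A B C D i l \<subseteq> span (decoupling_directions A B C D i l)"
  proof
    fix v assume "v \<in> R_sub A B C D i l"
    then obtain w c where w: "(A - l *\<^sub>R mat 1) *v v + B *v w = 0" "C *v v + D *v w = c *\<^sub>R axis i 1"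
      by (rule R_subE)
    obtain x u where x: "(A - l *\<^sub>R mat 1) *v x + B *v u = 0" "C *v x + D *v u = axis i 1"
      by (rule pencil_surj[OF assms])
    show "v \<in> span (decoupling_directions A B C D i l)"
    proof (cases "c = 0")
      case True
      have "v + x \<in> decoupling_directions A B C D i l"
        unfolding decoupling_directions_def
      proof (intro CollectI exI[of _ "w + u"] exI[of _ 1] conjI)
        have "(A - l *\<^sub>R mat 1) *v (v + x) + B *v (w + u) =
            ((A - l *\<^sub>R mat 1) *v v + B *v w) + ((A - l *\<^sub>R mat 1) *v x + B *v u)"
          by (simp add: matrix_vector_right_distrib algebra_simps)
        then show "(A - l *\<^sub>R mat 1) *v (v + x) + B *v (w + u) = 0" unfolding w x by simp
        have "C *v (v + x) + D *v (w + u) = (C *v v + D *v w) + (C *v x + D *v u)"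
          by (simp add: matrix_vector_right_distrib algebra_simps)
        then show "C *v (v + x) + D *v (w + u) = 1 *\<^sub>R axis i 1" unfolding w x True by simp
      qed simp
      moreover have "x \<in> decoupling_directions A B C D i l"
        unfolding decoupling_directions_def using x
        by (intro CollectI exI[of _ u] exI[of _ 1]) simp
      ultimately have "(v + x) - x \<in> span (decoupling_directions A B C D i l)"
        by (intro span_diff span_base)
      then show ?thesis by simp
    next
      case False
      then show ?thesis using w by (intro span_base) (auto simp: decoupling_directions_def)
    qed
  qed
qed

section \<open>Eigenvector bases and the dimension inequalities\<close>

lemma mem_mode_index:
  "(None, j) \<in> mode_index \<nu>0 \<nu> \<longleftrightarrow> j \<in> {1..\<nu>0}" "(Some i, j) \<in> mode_index \<nu>0 \<nu> \<longleftrightarrow> j \<in> {1..\<nu> i}"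
  by (simp_all add: mode_index_def)

text \<open>The eigenvectors with indices in \<open>P\<close> lie in \<open>U\<close>, the
  \<open>\<nu>0\<close> unobservable ones in \<open>stable_output_zeroing\<close>. Being part of a
  basis, they bound the dimensions from below.\<close>

lemma eigenbasis_dim_bounds:
  fixes A :: "real^'n^'n" and B :: "real^'m^'n" and C :: "real^'n^'p" and D :: "real^'m^'p"
  assumes basis: "has_decoupling_eigenbasis A B C D F \<nu>0 \<nu> \<mu>"
    and stable: "spectrum (A + B ** F) \<subseteq> stability_region \<tau>"
    and P: "P \<subseteq> (SIGMA i : UNIV. {1..\<nu> i})"
  defines "U \<equiv> \<Union>(i, j)\<in>P. R_sub A B C D i (\<mu> i j)"
  shows "card P \<le> dim U" "card P + \<nu>0 \<le> dim (stable_output_zeroing \<tau> A B C D \<union> U)"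
proof -
  define J where "J = mode_index \<nu>0 \<nu>"
  obtain \<mu>0 v where *: "inj_on v J \<and> independent (v ` J) \<and> span (v ` J) = UNIV \<and>
        (\<forall>j\<in>{1..\<nu>0}. (A + B ** F) *v v (None, j) = \<mu>0 j *\<^sub>R v (None, j) \<and>
           (C + D ** F) *v v (None, j) = 0) \<and>
        (\<forall>i. \<forall>j\<in>{1..\<nu> i}. (A + B ** F) *v v (Some i, j) = \<mu> i j *\<^sub>R v (Some i, j) \<and>
           (\<exists>c. c \<noteq> 0 \<and> (C + D ** F) *v v (Some i, j) = c *\<^sub>R axis i 1))"
    using basis unfolding has_decoupling_eigenbasis_def J_def by (elim exE)
  define emb where "emb = (\<lambda>(i, j). (Some i, j) :: 'p option \<times> nat)"
  define N where "N = (\<lambda>j. (None, j) :: 'p option \<times> nat) ` {1..\<nu>0}"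
  have inj: "inj_on v J" and ind: "independent (v ` J)" using * by simp_all
  have finP: "finite P" using P by (rule finite_subset) auto
  have emb: "emb ` P \<subseteq> J" using P by (auto simp: emb_def J_def mem_mode_index)
  have N: "N \<subseteq> J" by (auto simp: N_def J_def mem_mode_index)
  have disj: "emb ` P \<inter> N = {}" by (auto simp: emb_def N_def)
  have card_emb: "card (emb ` P) = card P" by (rule card_image) (auto simp: emb_def inj_on_def)
  have card_N: "card N = \<nu>0" unfolding N_def by (subst card_image) (auto simp: inj_on_def)
  have lower: "card Q \<le> dim T" if "Q \<subseteq> J" "v ` Q \<subseteq> T" for Q T
  proof -
    have "card Q = card (v ` Q)" using inj_on_subset[OF inj \<open>Q \<subseteq> J\<close>] by (simp add: card_image)
    also have "\<dots> \<le> dim T"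
      by (rule independent_card_le_dim[OF that(2) independent_mono[OF ind image_mono[OF that(1)]]])
    finally show ?thesis .
  qed
  have v_emb: "v ` emb ` P \<subseteq> U"
    unfolding image_image
  proof (rule image_subsetI)
    fix p assume "p \<in> P"
    obtain i j where p: "p = (i, j)" by (cases p)
    have "j \<in> {1..\<nu> i}" using \<open>p \<in> P\<close> P p by auto
    then obtain c where v: "(A + B ** F) *v v (Some i, j) = \<mu> i j *\<^sub>R v (Some i, j)"
      "(C + D ** F) *v v (Some i, j) = c *\<^sub>R axis i 1" using * by blast
    have "v (Some i, j) \<in> R_sub A B C D i (\<mu> i j)"
      unfolding R_sub_def
    proof (intro CollectI exI[of _ "F *v v (Some i, j)"] conjI allI impI)
      show "(A - \<mu> i j *\<^sub>R mat 1) *v v (Some i, j) + B *v (F *v v (Some i, j)) = 0"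
        using v(1) by (simp only: closed_loop_mult eigenvector_pencil_iff)
      show "(C *v v (Some i, j) + D *v (F *v v (Some i, j))) $ k = 0" if "k \<noteq> i" for k
        unfolding closed_loop_mult(2)[symmetric] v(2) using that by (simp add: axis_def)
    qed
    then show "v (emb p) \<in> U" using \<open>p \<in> P\<close> by (auto simp: U_def emb_def p)
  qed
  have v_N: "v ` N \<subseteq> stable_output_zeroing \<tau> A B C D"
    unfolding N_def image_image
  proof (rule image_subsetI)
    fix j assume j: "j \<in> {1..\<nu>0}"
    then have v: "(A + B ** F) *v v (None, j) = \<mu>0 j *\<^sub>R v (None, j)" "(C + D ** F) *v v (None, j) = 0"
      using * by simp_all
    have "(None, j) \<in> J" using j by (simp add: J_def mem_mode_index)
    \<comment> \<open>Only a nonzero vector makes \<open>\<mu>0 j\<close> an eigenvalue, and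
      stability of \<open>\<mu>0 j\<close> is known only through the spectrum.\<close>
    then have "v (None, j) \<noteq> 0" using ind dependent_zero by (metis image_eqI)
    then have "complex_of_real (\<mu>0 j) \<in> stability_region \<tau>"
      using eigenvalue_in_spectrum_on[OF v(1)] stable by auto
    moreover have "v (None, j) \<in> output_zeroing A B C D (\<mu>0 j)"
      unfolding output_zeroing_def using v
      by (intro CollectI exI[of _ "F *v v (None, j)"]) (simp only: closed_loop_mult eigenvector_pencil_iff simp_thms)
    ultimately show "v (None, j) \<in> stable_output_zeroing \<tau> A B C D"
      unfolding stable_output_zeroing_def by blast
  qed
  show "card P \<le> dim U" using lower[OF emb v_emb] card_emb by simp
  have "card (emb ` P \<union> N) \<le> dim (stable_output_zeroing \<tau> A B C D \<union> U)"
    by (rule lower) (use emb N v_emb v_N in blast)+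
  then show "card P + \<nu>0 \<le> dim (stable_output_zeroing \<tau> A B C D \<union> U)"
    using disj finP by (simp add: card_Un_disjoint card_emb card_N N_def[symmetric] finite_subset[OF N finite_mode_index[of \<nu>0 \<nu>, folded J_def]])
qed

text \<open>Rado's theorem is applied with \<open>\<nu>0\<close> copies of \<open>W\<close> and one
  set of decoupling directions per assigned eigenvalue. For an index set with no copy of
  \<open>W\<close> its condition is the inequality without \<open>\<nu>0\<close>. Once a copy
  occurs, all of \<open>W\<close> is in the union and at most \<open>\<nu>0\<close> copies are
  counted, so the other inequality suffices.\<close>

lemma decoupling_directions_transversal:
  fixes A :: "real^'n^'n" and B :: "real^'m^'n" and C :: "real^'n^'p" and D :: "real^'m^'p"
  assumes ri: "right_invertible A B C D"
    and \<mu>: "\<And>i j. j \<in> {1..\<nu> i} \<Longrightarrow> complex_of_real (\<mu> i j) \<notin> invariant_zeros A B C D"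
    and dim: "\<And>P. P \<subseteq> (SIGMA i : UNIV. {1..\<nu> i}) \<Longrightarrow>
      card P \<le> dim (\<Union>(i, j)\<in>P. R_sub A B C D i (\<mu> i j)) \<and>
      card P + \<nu>0 \<le> dim (W \<union> (\<Union>(i, j)\<in>P. R_sub A B C D i (\<mu> i j)))"
  obtains v where "\<And>j. j \<in> {1..\<nu>0} \<Longrightarrow> v (None, j) \<in> W"
    "\<And>i j. j \<in> {1..\<nu> i} \<Longrightarrow> v (Some i, j) \<in> decoupling_directions A B C D i (\<mu> i j)"
    "inj_on v (mode_index \<nu>0 \<nu>)" "independent (v ` mode_index \<nu>0 \<nu>)"
proof -
  define J where "J = mode_index \<nu>0 \<nu>"
  define X where "X k = (case k of (None, j) \<Rightarrow> W | (Some i, j) \<Rightarrow> decoupling_directions A B C D i (\<mu> i j))"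
    for k :: "'p option \<times> nat"
  have finJ: "finite J" unfolding J_def by (rule finite_mode_index)
  have rado: "card Q \<le> dim (\<Union>k\<in>Q. X k)" if Q: "Q \<subseteq> J" for Q
  proof -
    define emb where "emb = (\<lambda>(i, j). (Some i, j) :: 'p option \<times> nat)"
    define P where "P = {(i, j). (Some i, j) \<in> Q}"
    define N where "N = {j. (None, j) \<in> Q}"
    define U where "U = (\<Union>(i, j)\<in>P. R_sub A B C D i (\<mu> i j))"
    have P: "P \<subseteq> (SIGMA i : UNIV. {1..\<nu> i})" and N: "N \<subseteq> {1..\<nu>0}"
      using Q by (auto simp: P_def N_def J_def mem_mode_index)
    have "Q = emb ` P \<union> (\<lambda>j. (None, j)) ` N"
    proof (intro subset_antisym subsetI)
      fix k assume "k \<in> Q"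
      then show "k \<in> emb ` P \<union> (\<lambda>j. (None, j)) ` N"
        by (cases k; cases "fst k") (auto simp: P_def N_def emb_def image_iff)
    qed (auto simp: P_def N_def emb_def)
    then have "card Q \<le> card (emb ` P) + card ((\<lambda>j. (None :: 'p option, j)) ` N)"
      by (simp add: card_Un_le)
    also have "\<dots> = card P + card N"
      by (intro arg_cong2[of _ _ _ _ "(+)"] card_image) (auto simp: emb_def inj_on_def)
    finally have card_Q: "card Q \<le> card P + card N" .
    have U_sub: "U \<subseteq> span (\<Union>k\<in>Q. X k)"
      unfolding U_def
    proof (intro UN_least, clarify)
      fix i j x assume ij: "(i, j) \<in> P" and x: "x \<in> R_sub A B C D i (\<mu> i j)"
      have "j \<in> {1..\<nu> i}" using P ij by auto
      then have "x \<in> span (X (Some i, j))"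
        using x span_decoupling_directions[OF ri \<mu>] by (simp add: X_def)
      moreover have "X (Some i, j) \<subseteq> (\<Union>k\<in>Q. X k)" using ij by (auto simp: P_def)
      ultimately show "x \<in> span (\<Union>k\<in>Q. X k)" using span_mono by blast
    qed
    show ?thesis
    proof (cases "N = {}")
      case True
      have "card P \<le> dim U" using dim[OF P] by (simp add: U_def)
      also have "\<dots> \<le> dim (\<Union>k\<in>Q. X k)" by (rule dim_mono[OF U_sub])
      finally show ?thesis using card_Q True by simp
    next
      case False
      then obtain j where "(None, j) \<in> Q" by (auto simp: N_def)
      then have "W \<subseteq> (\<Union>k\<in>Q. X k)" by (force simp: X_def)
      then have "W \<union> U \<subseteq> span (\<Union>k\<in>Q. X k)" using U_sub span_superset by blast
      then have "dim (W \<union> U) \<le> dim (\<Union>k\<in>Q. X k)" by (rule dim_mono)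
      moreover have "card P + \<nu>0 \<le> dim (W \<union> U)" using dim[OF P] by (simp add: U_def)
      moreover have "card N \<le> \<nu>0" using card_mono[OF _ N] by simp
      ultimately show ?thesis using card_Q by linarith
    qed
  qed
  obtain v where v: "\<And>k. k \<in> J \<Longrightarrow> v k \<in> X k" "inj_on v J" "independent (v ` J)"
    using independent_transversal[OF finJ rado] by metis
  show ?thesis
  proof (rule that[of v])
    show "v (None, j) \<in> W" if "j \<in> {1..\<nu>0}" for j
      using v(1)[of "(None, j)"] that by (simp add: X_def J_def mem_mode_index)
    show "v (Some i, j) \<in> decoupling_directions A B C D i (\<mu> i j)" if "j \<in> {1..\<nu> i}" for i j
      using v(1)[of "(Some i, j)"] that by (simp add: X_def J_def mem_mode_index)
  qed (use v J_def in auto)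
qed

text \<open>The numbers of vectors add up to \<open>CARD('n)\<close>, so the transversal is a basis.
  One feedback realizes all chosen inputs at once, which makes the basis an eigenbasis of the closed
  loop; stability, tracking and decoupling follow from it.\<close>

lemma transversal_solves:
  fixes A :: "real^'n^'n" and B :: "real^'m^'n" and C :: "real^'n^'p" and D :: "real^'m^'p"
    and \<nu> :: "'p \<Rightarrow> nat"
  assumes ri: "right_invertible A B C D"
    and s: "complex_of_real (reference_eigenvalue \<tau>) \<notin> invariant_zeros A B C D"
    and \<nu>: "(\<Sum>i\<in>UNIV. \<nu> i) \<le> CARD('n)"
    and \<mu>: "\<And>i j. j \<in> {1..\<nu> i} \<Longrightarrow> complex_of_real (\<mu> i j) \<in> stability_region \<tau>"
    and v0: "\<And>j. j \<in> {1..\<nu>0} \<Longrightarrow> v (None, j) \<in> stable_output_zeroing \<tau> A B C D"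
    and v1: "\<And>i j. j \<in> {1..\<nu> i} \<Longrightarrow> v (Some i, j) \<in> decoupling_directions A B C D i (\<mu> i j)"
    and inj: "inj_on v (mode_index \<nu>0 \<nu>)" and ind: "independent (v ` mode_index \<nu>0 \<nu>)"
    and \<nu>0: "\<nu>0 = CARD('n) - (\<Sum>i\<in>UNIV. \<nu> i)"
  shows "problem_1B_solvable \<tau> A B C D \<nu> \<mu>"
proof -
  define J where "J = mode_index \<nu>0 \<nu>"
  have "card J = CARD('n)" unfolding J_def card_mode_index using \<nu> \<nu>0 by simp
  then have "card (v ` J) = dim (UNIV :: (real^'n) set)" using inj by (simp add: card_image J_def)
  then have span: "span (v ` J) = UNIV"
    using card_ge_dim_independent[of "v ` J" UNIV] ind by (auto simp: J_def)
  have "\<exists>l w. complex_of_real l \<in> stability_region \<tau> \<and> (A - l *\<^sub>R mat 1) *v v k + B *v w = 0 \<and>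
      (case k of (None, j) \<Rightarrow> C *v v k + D *v w = 0
        | (Some i, j) \<Rightarrow> l = \<mu> i j \<and> (\<exists>c. c \<noteq> 0 \<and> C *v v k + D *v w = c *\<^sub>R axis i 1))"
    if k: "k \<in> J" for k
  proof -
    obtain i j where ij: "k = (i, j)" by (cases k)
    show ?thesis
    proof (cases i)
      case None
      then have "j \<in> {1..\<nu>0}" using k ij by (simp add: J_def mem_mode_index)
      from v0[OF this] obtain l w where "complex_of_real l \<in> stability_region \<tau>"
        "(A - l *\<^sub>R mat 1) *v v k + B *v w = 0" "C *v v k + D *v w = 0"
        by (auto simp: stable_output_zeroing_def output_zeroing_def ij None)
      then show ?thesis by (auto simp: ij None)
    next
      case (Some h)
      then have j: "j \<in> {1..\<nu> h}" using k ij by (simp add: J_def mem_mode_index)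
      from v1[OF this] obtain w c where w: "(A - \<mu> h j *\<^sub>R mat 1) *v v k + B *v w = 0"
        "c \<noteq> 0 \<and> C *v v k + D *v w = c *\<^sub>R axis h 1"
        by (auto simp: decoupling_directions_def ij Some)
      show ?thesis
      proof (intro exI[of _ "\<mu> h j"] exI[of _ w] conjI \<mu>[OF j] w(1))
        show "case k of (None, j) \<Rightarrow> C *v v k + D *v w = 0
          | (Some i, ja) \<Rightarrow> \<mu> h j = \<mu> i ja \<and> (\<exists>c. c \<noteq> 0 \<and> C *v v k + D *v w = c *\<^sub>R axis i 1)"
          using w(2) unfolding ij Some prod.case option.case by blast
      qed
    qed
  qed
  then have "\<forall>k\<in>J. \<exists>l w. complex_of_real l \<in> stability_region \<tau> \<and> (A - l *\<^sub>R mat 1) *v v k + B *v w = 0 \<and>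
      (case k of (None, j) \<Rightarrow> C *v v k + D *v w = 0
        | (Some i, j) \<Rightarrow> l = \<mu> i j \<and> (\<exists>c. c \<noteq> 0 \<and> C *v v k + D *v w = c *\<^sub>R axis i 1))" by blast
  from bchoice[OF this] obtain l where
    "\<forall>k\<in>J. \<exists>w. complex_of_real (l k) \<in> stability_region \<tau> \<and> (A - l k *\<^sub>R mat 1) *v v k + B *v w = 0 \<and>
      (case k of (None, j) \<Rightarrow> C *v v k + D *v w = 0
        | (Some i, j) \<Rightarrow> l k = \<mu> i j \<and> (\<exists>c. c \<noteq> 0 \<and> C *v v k + D *v w = c *\<^sub>R axis i 1))"
    by (elim exE)
  from bchoice[OF this] obtain w where lw:
    "\<forall>k\<in>J. complex_of_real (l k) \<in> stability_region \<tau> \<and> (A - l k *\<^sub>R mat 1) *v v k + B *v w k = 0 \<and>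
      (case k of (None, j) \<Rightarrow> C *v v k + D *v w k = 0
        | (Some i, j) \<Rightarrow> l k = \<mu> i j \<and> (\<exists>c. c \<noteq> 0 \<and> C *v v k + D *v w k = c *\<^sub>R axis i 1))"
    by (elim exE)
  \<comment> \<open>The feedback is prescribed on vectors while inputs and eigenvalues are indexed
    by \<open>J\<close>; injectivity of \<open>v\<close> allows passing back.\<close>
  define k_of where "k_of = inv_into J v"
  have k_of: "k_of (v k) = k" if "k \<in> J" for k
    using inj that by (simp add: k_of_def J_def)
  obtain F where F_b: "\<And>b. b \<in> v ` J \<Longrightarrow> F *v b = w (k_of b)"
    using feedback_exists[OF ind[folded J_def], where w = "\<lambda>b. w (k_of b)"] by blast
  have F: "F *v v k = w k" if "k \<in> J" for k using F_b[of "v k"] that by (simp add: k_of)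
  have eig: "(A + B ** F) *v v k = l k *\<^sub>R v k" if "k \<in> J" for k
    unfolding closed_loop_mult eigenvector_pencil_iff F[OF that] using lw[rule_format, OF that] by (elim conjE)
  have stable_l: "complex_of_real (l k) \<in> stability_region \<tau>" if "k \<in> J" for k
    using lw[rule_format, OF that] by (elim conjE)
  have out: "(C + D ** F) *v v k = C *v v k + D *v w k" if "k \<in> J" for k
    by (simp only: closed_loop_mult F[OF that])
  have basis: "has_decoupling_eigenbasis A B C D F \<nu>0 \<nu> \<mu>"
    unfolding has_decoupling_eigenbasis_def J_def[symmetric]
  proof (intro exI[of _ "\<lambda>j. l (None, j)"] exI[of _ v] conjI ballI allI)
    fix j assume "j \<in> {1..\<nu>0}"
    then have k: "(None, j) \<in> J" by (simp add: J_def mem_mode_index)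
    show "(A + B ** F) *v v (None, j) = l (None, j) *\<^sub>R v (None, j)" by (rule eig[OF k])
    show "(C + D ** F) *v v (None, j) = 0" using lw[rule_format, OF k] by (simp add: out[OF k])
  next
    fix i j assume "j \<in> {1..\<nu> i}"
    then have k: "(Some i, j) \<in> J" by (simp add: J_def mem_mode_index)
    show "(A + B ** F) *v v (Some i, j) = \<mu> i j *\<^sub>R v (Some i, j)"
      using lw[rule_format, OF k] eig[OF k] by simp
    show "\<exists>c. c \<noteq> 0 \<and> (C + D ** F) *v v (Some i, j) = c *\<^sub>R axis i 1"
      using lw[rule_format, OF k] by (simp add: out[OF k])
  qed (use inj ind span in \<open>simp_all add: J_def\<close>)
  have "spectrum_on (A + B ** F) (span (v ` J)) \<subseteq> complex_of_real ` (l \<circ> k_of) ` v ` J"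
    by (rule spectrum_on_eigenbasis) (use ind eig k_of in \<open>auto simp: J_def\<close>)
  then have stable: "spectrum (A + B ** F) \<subseteq> stability_region \<tau>"
    using stable_l k_of by (auto simp: span)
  obtain G :: "real^'p^'m" where G: "static_gain \<tau> A B C D F ** G = mat 1"
    using static_gain_right_inverse[OF ri s stable] by (elim exE)
  have "tracks_constant_references \<tau> A B C D F G"
    by (rule eigenbasis_tracks[OF inj ind span[unfolded J_def] _ _ stable G, of l])
       (simp_all add: eig stable_l J_def[symmetric])
  then show ?thesis
    unfolding problem_1B_solvable_def \<nu>0[symmetric]
    using stable G basis eigenbasis_decoupled[OF basis] by blast
qed

theorem theorem10:
  fixes A :: "real^'n^'n" and B :: "real^'m^'n" and C :: "real^'n^'p" and D :: "real^'m^'p"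
    and \<tau> :: time_domain and \<nu> :: "'p \<Rightarrow> nat" and \<mu> :: "'p \<Rightarrow> nat \<Rightarrow> real"
  assumes "right_invertible A B C D"
    and "stabilizable \<tau> A B"
    and "(case \<tau> of Continuous \<Rightarrow> 0 | Discrete \<Rightarrow> 1) \<notin> invariant_zeros A B C D"
    and "\<forall>z \<in> invariant_zeros A B C D \<inter> stability_region \<tau>.
           zero_algebraic_multiplicity A B C D z = zero_geometric_multiplicity A B C D z"
    and "invariant_zeros A B C D \<inter> stability_region \<tau> \<subseteq> \<real>"
    and "(\<Sum>i\<in>UNIV. \<nu> i) \<le> CARD('n)"
    and "\<forall>i. \<forall>j\<in>{1..\<nu> i}.
           complex_of_real (\<mu> i j) \<in> stability_region \<tau> - invariant_zeros A B C D"
  defines "\<nu>0 \<equiv> CARD('n) - (\<Sum>i\<in>UNIV. \<nu> i)"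
    and "I \<equiv> (SIGMA i : UNIV. {1..\<nu> i})"
  shows "problem_1B_solvable \<tau> A B C D \<nu> \<mu> \<longleftrightarrow>
    (\<forall>P \<in> Pow I.
       dim (Vstar_g \<tau> A B C D + (\<Sum>(i, j)\<in>P. R_sub A B C D i (\<mu> i j))) \<ge> card P + \<nu>0 \<and>
       dim (\<Sum>(i, j)\<in>P. R_sub A B C D i (\<mu> i j)) \<ge> card P)"
proof -
  define W where "W = stable_output_zeroing \<tau> A B C D"
  define U where "U P = (\<Union>(i, j)\<in>P. R_sub A B C D i (\<mu> i j))" for P
  have s: "complex_of_real (reference_eigenvalue \<tau>) \<notin> invariant_zeros A B C D"
    using assms(3) by (cases \<tau>) (simp_all add: reference_eigenvalue_def)
  have sum: "(\<Sum>(i, j)\<in>P. R_sub A B C D i (\<mu> i j)) = span (U P)" if "P \<in> Pow I" for P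
  proof -
    have "finite P" using that unfolding I_def by (auto intro: finite_subset)
    then show ?thesis
      unfolding U_def by (rule sum_subspaces_eq_span) (auto simp: subspace_R_sub)
  qed
  \<comment> \<open>Dimension depends only on the span, so \<open>Vstar_g\<close> can be exchanged
    for the spanning set \<open>W\<close>, whose elements are admissible eigenvectors.\<close>
  have sum_W: "dim (Vstar_g \<tau> A B C D + span (U P)) = dim (W \<union> U P)" for P
  proof -
    have "Vstar_g \<tau> A B C D + span (U P) = span (span W \<union> span (U P))"
      unfolding Vstar_g_eq_span[OF assms(1,4,5)] W_def by (rule subspace_set_plus_eq_span) auto
    also have "\<dots> = span (W \<union> U P)" by (simp only: span_Un span_span)
    finally show ?thesis by simp
  qed
  have "problem_1B_solvable \<tau> A B C D \<nu> \<mu> \<longleftrightarrow>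
    (\<forall>P \<in> Pow I. card P + \<nu>0 \<le> dim (W \<union> U P) \<and> card P \<le> dim (U P))"
  proof
    assume "problem_1B_solvable \<tau> A B C D \<nu> \<mu>"
    then obtain F where F: "spectrum (A + B ** F) \<subseteq> stability_region \<tau>"
      "has_decoupling_eigenbasis A B C D F \<nu>0 \<nu> \<mu>"
      unfolding problem_1B_solvable_def \<nu>0_def by blast
    show "\<forall>P \<in> Pow I. card P + \<nu>0 \<le> dim (W \<union> U P) \<and> card P \<le> dim (U P)"
      using eigenbasis_dim_bounds[OF F(2,1)] unfolding I_def W_def U_def by blast
  next
    assume dims: "\<forall>P \<in> Pow I. card P + \<nu>0 \<le> dim (W \<union> U P) \<and> card P \<le> dim (U P)"
    obtain v where "\<And>j. j \<in> {1..\<nu>0} \<Longrightarrow> v (None, j) \<in> W"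
      "\<And>i j. j \<in> {1..\<nu> i} \<Longrightarrow> v (Some i, j) \<in> decoupling_directions A B C D i (\<mu> i j)"
      "inj_on v (mode_index \<nu>0 \<nu>)" "independent (v ` mode_index \<nu>0 \<nu>)"
      by (rule decoupling_directions_transversal[OF assms(1), of \<nu> \<mu> \<nu>0 W])
         (use assms(7) dims in \<open>auto simp: I_def U_def\<close>)
    then show "problem_1B_solvable \<tau> A B C D \<nu> \<mu>"
      by (intro transversal_solves[OF assms(1) s assms(6)]) (use assms(7) in \<open>auto simp: W_def \<nu>0_def\<close>)
  qed
  then show ?thesis by (simp add: sum sum_W)
qed

end
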